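(* Let $\varepsilon>0$ be fixed and $p=\frac{1+\varepsilon}{m}$. Then with high probability (as $m\to\infty$) the random subgraph $Q^m_p$ contains a cycle of length at least $\frac{2^{m}}{4m^{32}}=2^{(1-o(1))m}$.
   Context: $Q^m$ is the $m$-dimensional hypercube (vertex set $\{0,1\}^m$, adjacency when differing in exactly one coordinate). For a graph $G$ and $p\in[0,1]$, $G_p$ is the random spanning subgraph obtained by keeping each edge independently with probability $p$. *)

theory Defs
  imports "HOL-Probability.Probability" "HOL-Probability.Product_PMF" "HOL-Library.Landau_Symbols"
begin

text \<open>A graph is a pair of a vertex set and a set of edges, each edge being an unordered pair of
  distinct vertices.\<close>

type_synonym 'a graph = "'a set \<times> 'a set set"

definition verts :: "'a graph \<Rightarrow> 'a set" where
  "verts G = fst G"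

definition edges :: "'a graph \<Rightarrow> 'a set set" where
  "edges G = snd G"

definition hypercube :: "nat \<Rightarrow> (nat \<Rightarrow> nat) graph" where
  "hypercube m =
    (let V = {..<m} \<rightarrow>\<^sub>E {0, 1}
     in (V, {{x, y} | x y. x \<in> V \<and> y \<in> V \<and> card {i \<in> {..<m}. x i \<noteq> y i} = 1}))"

text \<open>The definition is meaningful for graphs with finitely many edges and for \<^term>\<open>p\<close> in the unit
  interval; \<^const>\<open>bernoulli_pmf\<close> truncates other values of \<^term>\<open>p\<close> to that interval.\<close>

definition random_subgraph :: "'a graph \<Rightarrow> real \<Rightarrow> 'a graph pmf" where
  "random_subgraph G p =
    map_pmf (\<lambda>keep. (verts G, {e \<in> edges G. keep e}))
      (Pi_pmf (edges G) False (\<lambda>_. bernoulli_pmf p))"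

text \<open>A cycle is given by its distinct vertices in cyclic order, without repeating the first one
  at the end, so its length (number of edges) is the length of the list.\<close>

definition is_cycle :: "'a graph \<Rightarrow> 'a list \<Rightarrow> bool" where
  "is_cycle G c \<longleftrightarrow>
    3 \<le> length c \<and> distinct c \<and> set c \<subseteq> verts G \<and>
    (\<forall>i < length c. {c ! i, c ! (Suc i mod length c)} \<in> edges G)"

end

theory Submission
  imports Defs "HOL-Real_Asymp.Real_Asymp"
begin

text \<open>Write the percolation with probability \<open>(1 + \<epsilon>) / m\<close> as the union of one with probability
  \<open>p = (1 + \<epsilon> / 2) / m\<close> and a sprinkling with probability about \<open>\<epsilon> / (2 m)\<close>. By edge isoperimetry, sets
  of polynomial size have edge boundary \<open>(1 - o(1)) m\<close> times their size, so in the first round every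
  vertex lies in a cluster of size at least \<open>m ^ 8\<close> with probability bounded away from 0. Almost every
  vertex therefore has a neighbour in such a cluster, as one sees in about \<open>sqrt m\<close> disjoint subcubes.

  A graph without cycles of length at least \<open>L\<close> has a separator of size at most \<open>L\<close> that splits any
  given vertex set into comparable parts. Splitting the large clusters in this way separates unions of pieces
  of these clusters. There are at most \<open>2 ^ (2 ^ m / m ^ 8 + m L)\<close> such unions for a given separator, while
  isoperimetry provides of the order of \<open>2 ^ m / m ^ 3\<close> disjoint paths of length at most 3 between the
  two sides. Each of them is open in the sprinkling with probability of order \<open>m ^ (-3)\<close>, and a union
  bound shows that for \<open>L\<close> about \<open>2 ^ m / (4 m ^ 32)\<close> all these splittings are destroyed.\<close>

section \<open>Random subsets\<close>

text \<open>The obstacle is that the separator depends on the sprinkled edges, so a union bound has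
  to run over all possible separations, and arbitrary bipartitions number about
  \<open>2 ^ (2 ^ m)\<close>. Only the trace of a side on the large clusters is recorded. This trace
  is closed under first-round edges that avoid the separator, so the candidates are few and known
  before the sprinkling. Links have length 3 because almost every vertex has a neighbour in one of
  the two sides: the neighbourhoods of the sides nearly cover the cube, and isoperimetry makes them
  meet or be joined by an edge. The union bound gains a factor whose logarithm is of order
  \<open>- 2 ^ m / m ^ 6\<close>. It must beat the number of cluster choices, which asks for a
  cluster size of higher order than \<open>m ^ 6\<close>, and the number of separators, which asks
  for \<open>m * L\<close> of lower order than \<open>2 ^ m / m ^ 6\<close>. Hence
  \<open>m ^ 8\<close> suffices and \<open>m ^ 32\<close> leaves much slack; any fixed power keeps
  the logarithm in the isoperimetric bound of order \<open>log m\<close>.\<close>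

definition percolate :: "'e set \<Rightarrow> real \<Rightarrow> 'e set pmf" where
  "percolate E p = map_pmf (\<lambda>k. {e \<in> E. k e}) (Pi_pmf E False (\<lambda>_. bernoulli_pmf p))"

lemma random_subgraph_percolate:
  "random_subgraph G p = map_pmf (Pair (verts G)) (percolate (edges G) p)"
  by (simp add: random_subgraph_def percolate_def map_pmf_comp)

lemma percolate_empty [simp]: "percolate {} p = return_pmf {}"
  by (simp add: percolate_def)

lemma percolate_insert:
  assumes "finite E" "e \<notin> E"
  shows "percolate (insert e E) p =
    map_pmf (\<lambda>(b, F). if b then insert e F else F) (pair_pmf (bernoulli_pmf p) (percolate E p))"
proof -
  have "percolate (insert e E) p = map_pmf (\<lambda>(b, k). {x \<in> insert e E. (k(e := b)) x})
      (pair_pmf (bernoulli_pmf p) (Pi_pmf E False (\<lambda>_. bernoulli_pmf p)))"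
    unfolding percolate_def Pi_pmf_insert[OF assms] by (simp add: map_pmf_comp case_prod_beta')
  also have "\<dots> = map_pmf (\<lambda>(b, k). if b then insert e {x \<in> E. k x} else {x \<in> E. k x})
      (pair_pmf (bernoulli_pmf p) (Pi_pmf E False (\<lambda>_. bernoulli_pmf p)))"
    using assms(2) by (intro map_pmf_cong) (auto split: if_splits)
  also have "\<dots> = map_pmf (\<lambda>(b, F). if b then insert e F else F)
      (pair_pmf (bernoulli_pmf p) (percolate E p))"
    by (simp add: percolate_def pair_map_pmf2 map_pmf_comp case_prod_beta' cong: if_cong)
  finally show ?thesis .
qed

lemma percolate_subset:
  assumes "F \<in> set_pmf (percolate E p)"
  shows "F \<subseteq> E"
  using assms by (auto simp: percolate_def)

lemma percolate_union:
  assumes "finite A" "finite B" "A \<inter> B = {}"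
  shows "percolate (A \<union> B) p =
    map_pmf (\<lambda>(F, G). F \<union> G) (pair_pmf (percolate A p) (percolate B p))"
  using assms(1,3)
proof (induction A rule: finite_induct)
  case empty
  then show ?case by (simp add: pair_return_pmf1 map_pmf_comp)
next
  case (insert a A)
  have "percolate (insert a A \<union> B) p = map_pmf (\<lambda>(b, F). if b then insert a F else F)
     (pair_pmf (bernoulli_pmf p) (percolate (A \<union> B) p))"
    using insert percolate_insert[of "A \<union> B" a p] assms by auto
  also have "\<dots> = bind_pmf (bernoulli_pmf p) (\<lambda>b. bind_pmf (percolate A p) (\<lambda>F.
      bind_pmf (percolate B p) (\<lambda>G. return_pmf (if b then insert a (F \<union> G) else F \<union> G))))"
    using insert by (simp add: pair_pmf_def map_pmf_def bind_assoc_pmf bind_return_pmf)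
  also have "\<dots> = map_pmf (\<lambda>(F, G). F \<union> G) (pair_pmf (percolate (insert a A) p) (percolate B p))"
    using insert.hyps
    by (auto simp: percolate_insert pair_pmf_def map_pmf_def bind_assoc_pmf bind_return_pmf
        intro!: bind_pmf_cong)
  finally show ?case .
qed

text \<open>One induction serves both couplings of two independent rounds: conjunction gives
  thinning, disjunction gives sprinkling.\<close>

lemma percolate_combine:
  assumes "finite E" and "\<not> f False False"
    and f: "map_pmf (\<lambda>(a, b). f a b) (pair_pmf (bernoulli_pmf p) (bernoulli_pmf q)) = bernoulli_pmf s"
  shows "percolate E s =
    map_pmf (\<lambda>(F, G). {e \<in> E. f (e \<in> F) (e \<in> G)}) (pair_pmf (percolate E p) (percolate E q))"
  using assms(1)
proof (induction E rule: finite_induct)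
  case empty
  then show ?case by (simp add: pair_return_pmf1 map_pmf_comp)
next
  case (insert e E)
  let ?c = "\<lambda>b F. if b then insert e F else F"
  have "percolate (insert e E) s = bind_pmf (bernoulli_pmf p) (\<lambda>a. bind_pmf (bernoulli_pmf q) (\<lambda>b.
      bind_pmf (percolate E p) (\<lambda>F. bind_pmf (percolate E q) (\<lambda>G.
        return_pmf (?c (f a b) {e \<in> E. f (e \<in> F) (e \<in> G)})))))"
    unfolding percolate_insert[OF insert.hyps] insert.IH f[symmetric]
    by (simp add: pair_pmf_def map_pmf_def bind_assoc_pmf bind_return_pmf)
  also have "\<dots> = bind_pmf (bernoulli_pmf p) (\<lambda>a. bind_pmf (bernoulli_pmf q) (\<lambda>b.
      bind_pmf (percolate E p) (\<lambda>F. bind_pmf (percolate E q) (\<lambda>G.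
        return_pmf {x \<in> insert e E. f (x \<in> ?c a F) (x \<in> ?c b G)}))))"
  proof (intro bind_pmf_cong refl)
    fix a b F G assume "F \<in> set_pmf (percolate E p)" "G \<in> set_pmf (percolate E q)"
    then have "e \<notin> F" "e \<notin> G" using insert.hyps percolate_subset by blast+
    then have *: "x \<in> ?c (f a b) {e \<in> E. f (e \<in> F) (e \<in> G)} \<longleftrightarrow>
        x \<in> {x \<in> insert e E. f (x \<in> ?c a F) (x \<in> ?c b G)}" for x
      using insert.hyps assms(2) by (cases "x = e"; cases a; cases b) auto
    have "?c (f a b) {e \<in> E. f (e \<in> F) (e \<in> G)} = {x \<in> insert e E. f (x \<in> ?c a F) (x \<in> ?c b G)}"
      by (rule set_eqI) (rule *)
    then show "return_pmf (?c (f a b) {e \<in> E. f (e \<in> F) (e \<in> G)}) =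
        return_pmf {x \<in> insert e E. f (x \<in> ?c a F) (x \<in> ?c b G)}" by (rule arg_cong)
  qed
  \<comment> \<open>Independent draws commute, so each coin can stand next to the percolation that
    it extends.\<close>
  also have "\<dots> = bind_pmf (bernoulli_pmf p) (\<lambda>a. bind_pmf (percolate E p) (\<lambda>F.
      bind_pmf (bernoulli_pmf q) (\<lambda>b. bind_pmf (percolate E q) (\<lambda>G.
        return_pmf {x \<in> insert e E. f (x \<in> ?c a F) (x \<in> ?c b G)}))))"
    by (subst bind_commute_pmf) simp
  also have "\<dots> = map_pmf (\<lambda>(F, G). {x \<in> insert e E. f (x \<in> F) (x \<in> G)})
      (pair_pmf (percolate (insert e E) p) (percolate (insert e E) q))"
    unfolding percolate_insert[OF insert.hyps]
    by (simp add: pair_pmf_def map_pmf_def bind_assoc_pmf bind_return_pmf)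
  finally show ?case .
qed

lemma bernoulli_pmf_eqI:
  assumes "0 \<le> p" "p \<le> 1" "pmf M True = p"
  shows "M = bernoulli_pmf p"
proof (rule pmf_eqI)
  have "pmf M False = 1 - pmf M True" by (rule pmf_False_conv_True)
  then show "pmf M b = pmf (bernoulli_pmf p) b" for b
    using assms by (cases b) auto
qed

lemma prob_bernoulli:
  assumes "0 \<le> p" "p \<le> 1"
  shows "measure_pmf.prob (bernoulli_pmf p) {b. b} = p"
    "measure_pmf.prob (bernoulli_pmf p) {b. \<not> b} = 1 - p"
proof -
  have "{b. b} = {True}" "{b. \<not> b} = {False}" by auto
  then show "measure_pmf.prob (bernoulli_pmf p) {b. b} = p"
    "measure_pmf.prob (bernoulli_pmf p) {b. \<not> b} = 1 - p"
    using assms by (simp_all add: measure_pmf_single)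
qed

lemma percolate_thin:
  assumes "finite E" "0 \<le> p" "p \<le> 1" "0 \<le> r" "r \<le> 1"
  shows "percolate E (p * r) =
    map_pmf (\<lambda>(F, R). F \<inter> R) (pair_pmf (percolate E p) (percolate E r))"
proof -
  have "map_pmf (\<lambda>(a, b). a \<and> b) (pair_pmf (bernoulli_pmf p) (bernoulli_pmf r)) = bernoulli_pmf (p * r)"
    using assms
    by (intro bernoulli_pmf_eqI)
       (auto simp: measure_pmf_single map_pmf_def pair_pmf_def bind_assoc_pmf bind_return_pmf pmf_bind mult_le_one algebra_simps)
  from percolate_combine[OF assms(1) _ this]
  have "percolate E (p * r) = map_pmf (\<lambda>(F, R). {e \<in> E. e \<in> F \<and> e \<in> R}) (pair_pmf (percolate E p) (percolate E r))"
    by simp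
  also have "\<dots> = map_pmf (\<lambda>(F, R). F \<inter> R) (pair_pmf (percolate E p) (percolate E r))"
    using percolate_subset[of _ E] by (intro map_pmf_cong refl) (auto; blast)
  finally show ?thesis .
qed

lemma percolate_sprinkle:
  assumes "finite E" "0 \<le> p" "p \<le> 1" "0 \<le> q" "q \<le> 1"
  shows "percolate E (1 - (1 - p) * (1 - q)) =
    map_pmf (\<lambda>(F, G). F \<union> G) (pair_pmf (percolate E p) (percolate E q))"
proof -
  have "0 \<le> (1 - p) * (1 - q)" "(1 - p) * (1 - q) \<le> 1"
    using assms by (auto intro: mult_le_one)
  then have "map_pmf (\<lambda>(a, b). a \<or> b) (pair_pmf (bernoulli_pmf p) (bernoulli_pmf q))
      = bernoulli_pmf (1 - (1 - p) * (1 - q))"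
    using assms
    by (intro bernoulli_pmf_eqI)
       (auto simp: map_pmf_def pair_pmf_def bind_assoc_pmf bind_return_pmf pmf_bind algebra_simps)
  from percolate_combine[OF assms(1) _ this]
  have "percolate E (1 - (1 - p) * (1 - q)) = map_pmf (\<lambda>(F, R). {e \<in> E. e \<in> F \<or> e \<in> R}) (pair_pmf (percolate E p) (percolate E q))"
    by simp
  also have "\<dots> = map_pmf (\<lambda>(F, R). F \<union> R) (pair_pmf (percolate E p) (percolate E q))"
    using percolate_subset[of _ E] by (intro map_pmf_cong refl) (auto; blast)
  finally show ?thesis .
qed

lemma prob_pair:
  "measure_pmf.prob (pair_pmf M N) {(x, y). R x y} =
    measure_pmf.expectation M (\<lambda>x. measure_pmf.prob N {y. R x y})"
proof -
  have "measure_pmf.prob (bind_pmf M (\<lambda>x. map_pmf (Pair x) N)) {(x, y). R x y} =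
    measure_pmf.expectation M (\<lambda>x. measure_pmf.prob (map_pmf (Pair x) N) {(x, y). R x y})"
    by (subst ennreal_inj[symmetric])
       (auto simp: measure_pmf.emeasure_eq_measure[symmetric] nn_integral_eq_integral[symmetric]
          measure_pmf.integrable_const_bound[where B = 1] simp del: measure_map_pmf)
  then show ?thesis by (simp add: pair_pmf_def map_pmf_def[symmetric] vimage_def)
qed

lemma prob_pair_times:
  "measure_pmf.prob (pair_pmf M N) {(x, y). P x \<and> Q y} =
    measure_pmf.prob M {x. P x} * measure_pmf.prob N {y. Q y}"
proof -
  have "(\<integral>x. measure_pmf.prob N {y. P x \<and> Q y} \<partial>measure_pmf M) =
      (\<integral>x. indicator {x. P x} x * measure_pmf.prob N {y. Q y} \<partial>measure_pmf M)"
    by (intro Bochner_Integration.integral_cong) (auto simp: indicator_def)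
  then show ?thesis unfolding prob_pair by simp
qed

text \<open>Splitting \<open>E\<close> into \<open>A\<close> and \<open>E - A\<close> makes the
  percolation a product; the two events are phrased by \<open>F \<inter> A\<close> and
  \<open>F - A\<close> to read off its components.\<close>

lemma percolate_indep:
  assumes "finite E" "A \<subseteq> E"
  shows "measure_pmf.prob (percolate E p) {F. P (F \<inter> A) \<and> Q (F - A)} =
    measure_pmf.prob (percolate A p) {F. P F} * measure_pmf.prob (percolate (E - A) p) {F. Q F}"
proof -
  have E: "percolate E p = map_pmf (\<lambda>(F, G). F \<union> G) (pair_pmf (percolate A p) (percolate (E - A) p))"
    using percolate_union[of A "E - A" p] assms by (auto simp: finite_subset Un_absorb1)
  have "measure_pmf.prob (percolate E p) {F. P (F \<inter> A) \<and> Q (F - A)}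
      = measure_pmf.prob (pair_pmf (percolate A p) (percolate (E - A) p))
          {x. P ((fst x \<union> snd x) \<inter> A) \<and> Q ((fst x \<union> snd x) - A)}"
    unfolding E by (simp add: vimage_def case_prod_beta')
  also have "\<dots> = measure_pmf.prob (pair_pmf (percolate A p) (percolate (E - A) p)) {(x, y). P x \<and> Q y}"
  proof (intro measure_pmf.finite_measure_eq_AE)
    \<comment> \<open>The events agree only on the support: elsewhere a component may contain edges
      of the wrong part.\<close>
    show "AE x in measure_pmf (pair_pmf (percolate A p) (percolate (E - A) p)).
        (x \<in> {x. P ((fst x \<union> snd x) \<inter> A) \<and> Q ((fst x \<union> snd x) - A)}) = (x \<in> {(x, y). P x \<and> Q y})"
    proof (rule AE_pmfI)
      fix x assume "x \<in> set_pmf (pair_pmf (percolate A p) (percolate (E - A) p))"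
      then have "fst x \<subseteq> A" "snd x \<subseteq> E - A" using percolate_subset by fastforce+
      then have "(fst x \<union> snd x) \<inter> A = fst x" "(fst x \<union> snd x) - A = snd x" by auto
      then show "(x \<in> {x. P ((fst x \<union> snd x) \<inter> A) \<and> Q ((fst x \<union> snd x) - A)}) = (x \<in> {(x, y). P x \<and> Q y})"
        by (simp add: case_prod_beta')
    qed
  qed auto
  also note prob_pair_times
  finally show ?thesis .
qed

lemma percolate_restrict:
  assumes "finite E" "A \<subseteq> E"
  shows "measure_pmf.prob (percolate E p) {F. P (F \<inter> A)} = measure_pmf.prob (percolate A p) {F. P F}"
  using percolate_indep[OF assms, of p P "\<lambda>_. True"] by simp

lemma percolate_indep_family:
  assumes "finite I" "finite E" "disjoint_family_on A I" "\<And>i. i \<in> I \<Longrightarrow> A i \<subseteq> E"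
  shows "measure_pmf.prob (percolate E p) {F. \<forall>i\<in>I. P i (F \<inter> A i)} =
    (\<Prod>i\<in>I. measure_pmf.prob (percolate E p) {F. P i (F \<inter> A i)})"
  using assms
\<comment> \<open>\<open>E\<close> varies because splitting off \<open>A i\<close> leaves a
  percolation on \<open>E - A i\<close>.\<close>
proof (induction I arbitrary: E rule: finite_induct)
  case empty
  then show ?case by simp
next
  case (insert i I)
  have sub: "A j \<subseteq> E - A i" if "j \<in> I" for j
    using insert.prems insert.hyps that unfolding disjoint_family_on_def by (metis Diff_disjoint
      Diff_subset_conv Int_commute disjoint_eq_subset_Compl insertCI Diff_eq Int_subset_iff)
  have fin: "finite (E - A i)" using insert.prems by auto
  have eq: "(F - A i) \<inter> A j = F \<inter> A j" if "j \<in> I" for F j using sub[OF that] by auto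
  have "measure_pmf.prob (percolate E p) {F. \<forall>j\<in>insert i I. P j (F \<inter> A j)}
     = measure_pmf.prob (percolate E p) {F. P i (F \<inter> A i) \<and> (\<forall>j\<in>I. P j ((F - A i) \<inter> A j))}"
    using eq by simp
  also have "\<dots> = measure_pmf.prob (percolate (A i) p) {F. P i F} *
      measure_pmf.prob (percolate (E - A i) p) {F. \<forall>j\<in>I. P j (F \<inter> A j)}"
    using insert.prems by (intro percolate_indep) auto
  also have "measure_pmf.prob (percolate (E - A i) p) {F. \<forall>j\<in>I. P j (F \<inter> A j)} =
      (\<Prod>j\<in>I. measure_pmf.prob (percolate (E - A i) p) {F. P j (F \<inter> A j)})"
    using insert.prems fin sub by (intro insert.IH) (auto simp: disjoint_family_on_def)
  also have "\<dots> = (\<Prod>j\<in>I. measure_pmf.prob (percolate E p) {F. P j (F \<inter> A j)})"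
  proof (intro prod.cong refl)
    fix j assume j: "j \<in> I"
    show "measure_pmf.prob (percolate (E - A i) p) {F. P j (F \<inter> A j)} =
        measure_pmf.prob (percolate E p) {F. P j (F \<inter> A j)}"
      using percolate_restrict[of "E - A i" "A j" p "P j"] percolate_restrict[of E "A j" p "P j"]
        fin sub[OF j] insert.prems j by simp
  qed
  also have "measure_pmf.prob (percolate (A i) p) {F. P i F} = measure_pmf.prob (percolate E p) {F. P i (F \<inter> A i)}"
    using percolate_restrict[of E "A i" p "P i"] insert.prems by simp
  finally show ?case using insert.hyps by simp
qed

lemma percolate_prob_superset:
  assumes "finite E" "T \<subseteq> E" "0 \<le> p" "p \<le> 1"
  shows "measure_pmf.prob (percolate E p) {F. T \<subseteq> F} = p ^ card T"
proof -
  have "finite T" using assms finite_subset by blast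
  then show ?thesis using assms(1,2)
  proof (induction T arbitrary: E rule: finite_induct)
    case empty
    then show ?case by simp
  next
    case (insert e T)
    define E' where "E' = E - {e}"
    have E': "E = insert e E'" "e \<notin> E'" "finite E'" "T \<subseteq> E'" using insert by (auto simp: E'_def)
    have "measure_pmf.prob (percolate E p) {F. insert e T \<subseteq> F}
       = measure_pmf.prob (pair_pmf (bernoulli_pmf p) (percolate E' p)) {x. insert e T \<subseteq> (if fst x then insert e (snd x) else snd x)}"
      unfolding E'(1) percolate_insert[OF E'(3,2)] by (simp add: vimage_def case_prod_beta')
    also have "\<dots> = measure_pmf.prob (pair_pmf (bernoulli_pmf p) (percolate E' p)) {(x, y). x \<and> T \<subseteq> y}"
    proof (intro measure_pmf.finite_measure_eq_AE)
      show "AE x in measure_pmf (pair_pmf (bernoulli_pmf p) (percolate E' p)).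
        (x \<in> {x. insert e T \<subseteq> (if fst x then insert e (snd x) else snd x)}) = (x \<in> {(x, y). x \<and> T \<subseteq> y})"
      proof (rule AE_pmfI)
        fix x assume "x \<in> set_pmf (pair_pmf (bernoulli_pmf p) (percolate E' p))"
        then have "snd x \<subseteq> E'" using percolate_subset by fastforce
        then show "(x \<in> {x. insert e T \<subseteq> (if fst x then insert e (snd x) else snd x)}) = (x \<in> {(x, y). x \<and> T \<subseteq> y})"
          using E' insert.hyps by (cases x) auto
      qed
    qed auto
    also have "\<dots> = p * p ^ card T"
      unfolding prob_pair_times using insert.IH[OF E'(3,4)] assms(3,4) by (simp add: prob_bernoulli)
    finally show ?case using insert.hyps by simp
  qed
qed

lemma percolate_prob_empty:
  assumes "finite E" "0 \<le> p" "p \<le> 1"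
  shows "measure_pmf.prob (percolate E p) {F. F = {}} = (1 - p) ^ card E"
  using assms(1)
proof (induction E rule: finite_induct)
  case empty
  then show ?case by simp
next
  case (insert e E)
  have "measure_pmf.prob (percolate (insert e E) p) {F. F = {}}
     = measure_pmf.prob (pair_pmf (bernoulli_pmf p) (percolate E p)) {(x, y). \<not> x \<and> y = {}}"
    unfolding percolate_insert[OF insert.hyps]
    by (auto simp: vimage_def case_prod_beta' intro!: arg_cong[where f = "measure_pmf.prob _"] split: if_splits)
  also have "\<dots> = (1 - p) * (1 - p) ^ card E"
    unfolding prob_pair_times using insert.IH assms by (simp add: prob_bernoulli)
  finally show ?case using insert.hyps by simp
qed

section \<open>Clusters\<close>

definition adj :: "'a set set \<Rightarrow> 'a set \<Rightarrow> ('a \<times> 'a) set" where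
  "adj F S = {(x, y). x \<in> S \<and> y \<in> S \<and> {x, y} \<in> F}"

text \<open>The component of \<open>v\<close> in the graph induced on \<open>S\<close>; the
  reflexive closure keeps \<open>v\<close> in it even when \<open>v\<close> lies outside
  \<open>S\<close>.\<close>

definition cluster :: "'a set set \<Rightarrow> 'a set \<Rightarrow> 'a \<Rightarrow> 'a set" where
  "cluster F S v = (adj F S)\<^sup>* `` {v}"

text \<open>The edge boundary, relative to \<open>E\<close>: restricting \<open>E\<close> to the
  edges inside a subcube yields the boundary within that subcube.\<close>

definition bd :: "'a set set \<Rightarrow> 'a set \<Rightarrow> 'a set set" where
  "bd E C = {e \<in> E. \<exists>x y. x \<in> C \<and> y \<notin> C \<and> e = {x, y}}"

lemma cluster_refl [simp]: "v \<in> cluster F S v"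
  by (simp add: cluster_def)

lemma cluster_closed:
  assumes "v \<in> D" "\<And>x y. \<lbrakk>x \<in> D; x \<in> S; y \<in> S; {x, y} \<in> F\<rbrakk> \<Longrightarrow> y \<in> D"
  shows "cluster F S v \<subseteq> D"
proof
  fix w assume "w \<in> cluster F S v"
  then have "(v, w) \<in> (adj F S)\<^sup>*" by (simp add: cluster_def)
  then show "w \<in> D"
    by (induction rule: rtrancl_induct) (use assms in \<open>auto simp: adj_def\<close>)
qed

lemma cluster_subset: "v \<in> S \<Longrightarrow> cluster F S v \<subseteq> S"
  by (rule cluster_closed)

lemma cluster_step:
  assumes "x \<in> cluster F S v" "x \<in> S" "y \<in> S" "{x, y} \<in> F"
  shows "y \<in> cluster F S v"
  using assms unfolding cluster_def adj_def
  by (auto intro: rtrancl_into_rtrancl)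

lemma cluster_mono:
  assumes "F \<subseteq> F'" "S \<subseteq> S'"
  shows "cluster F S v \<subseteq> cluster F' S' v"
  by (rule cluster_closed) (use assms in \<open>auto intro: cluster_step\<close>)

lemma cluster_eq:
  assumes "w \<in> cluster F S v"
  shows "cluster F S w = cluster F S v"
proof -
  have "sym ((adj F S)\<^sup>*)" by (intro sym_rtrancl) (auto simp: sym_def adj_def insert_commute)
  then have "(v, w) \<in> (adj F S)\<^sup>*" "(w, v) \<in> (adj F S)\<^sup>*"
    using assms by (auto simp: cluster_def dest: symD)
  then show ?thesis by (auto simp: cluster_def)
qed

text \<open>Only edges inside \<open>S\<close> enter \<open>adj F S\<close>. This locality is what
  makes clusters in disjoint regions independent.\<close>

lemma cluster_restrict:
  assumes "{e \<in> F. e \<subseteq> S} \<subseteq> A"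
  shows "cluster (F \<inter> A) S v = cluster F S v"
proof -
  have "adj (F \<inter> A) S = adj F S" using assms by (auto simp: adj_def)
  then show ?thesis by (simp add: cluster_def)
qed

text \<open>While the reached set \<open>D\<close> is not all of \<open>C\<close>, connectedness
  provides an edge of \<open>F\<close> from \<open>D\<close> to the rest of \<open>C\<close>; adding
  it reaches one more vertex at the cost of one edge.\<close>

lemma spanning_tree_exists:
  assumes "finite C" "v \<in> C" "cluster F C v = C"
  shows "\<exists>T \<subseteq> F. finite T \<and> card T < card C \<and> cluster T C v = C"
proof -
  have "\<exists>D T. D \<subseteq> C \<and> v \<in> D \<and> card D = Suc n \<and> T \<subseteq> F \<and> finite T \<and> card T \<le> n \<and> D \<subseteq> cluster T C v"
    if "n < card C" for n
    using that
  proof (induction n)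
    case 0
    then show ?case using assms(2) by (intro exI[of _ "{v}"] exI[of _ "{}"]) auto
  next
    case (Suc n)
    then obtain D T where DT: "D \<subseteq> C" "v \<in> D" "card D = Suc n" "T \<subseteq> F" "finite T" "card T \<le> n"
      "D \<subseteq> cluster T C v" by auto
    have "\<not> C \<subseteq> D" using DT Suc.prems by (metis nat_neq_iff subset_antisym)
    then obtain x y where xy: "x \<in> D" "y \<in> C" "{x, y} \<in> F" "y \<notin> D"
      using cluster_closed[of v D C F] assms(3) DT(2) by blast
    let ?T = "insert {x, y} T"
    have "cluster T C v \<subseteq> cluster ?T C v" by (rule cluster_mono) auto
    then have "D \<subseteq> cluster ?T C v" using DT by auto
    moreover have "y \<in> cluster ?T C v"
      by (rule cluster_step[of x]) (use \<open>D \<subseteq> cluster ?T C v\<close> xy DT in blast)+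
    moreover have "finite D" using DT assms(1) finite_subset by blast
    moreover have "card ?T \<le> Suc n" using DT(5,6) by (simp add: card_insert_if)
    ultimately show ?case using DT xy
      by (intro exI[of _ "insert y D"] exI[of _ ?T]) auto
  qed
  from this[of "card C - 1"] obtain D T where
    "D \<subseteq> C" "card D = card C" "T \<subseteq> F" "finite T" "card T < card C" "D \<subseteq> cluster T C v"
    using assms(1,2) by (metis Suc_pred' card_gt_0_iff diff_less empty_iff less_Suc_eq_le zero_less_one)
  moreover from this have "D = C" using assms(1) card_subset_eq by blast
  ultimately show ?thesis using cluster_subset[OF assms(2)] by blast
qed

text \<open>Connectedness of \<open>C\<close> concerns edges inside \<open>C\<close>, separation
  from the rest of \<open>S\<close> only boundary edges. The shape with \<open>\<inter>\<close> and
  \<open>-\<close> is the one that \<open>percolate_indep\<close> expects.\<close>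

lemma cluster_eq_iff:
  assumes "v \<in> C" "C \<subseteq> S" "F \<subseteq> E"
  shows "cluster F S v = C \<longleftrightarrow> cluster (F \<inter> {e \<in> E. e \<subseteq> C}) C v = C \<and>
    (F - {e \<in> E. e \<subseteq> C}) \<inter> bd {e \<in> E. e \<subseteq> S} C = {}"
proof -
  have R: "cluster (F \<inter> {e \<in> E. e \<subseteq> C}) C v = cluster F C v"
    using assms by (intro cluster_restrict) auto
  have B: "(F - {e \<in> E. e \<subseteq> C}) \<inter> bd {e \<in> E. e \<subseteq> S} C = {} \<longleftrightarrow> (\<forall>x\<in>C. \<forall>y\<in>S. {x, y} \<in> F \<longrightarrow> y \<in> C)"
  proof
    assume d: "(F - {e \<in> E. e \<subseteq> C}) \<inter> bd {e \<in> E. e \<subseteq> S} C = {}"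
    show "\<forall>x\<in>C. \<forall>y\<in>S. {x, y} \<in> F \<longrightarrow> y \<in> C"
    proof (intro ballI impI, rule ccontr)
      fix x y assume "x \<in> C" "y \<in> S" "{x, y} \<in> F" "y \<notin> C"
      moreover from this have "{x, y} \<in> E" "{x, y} \<subseteq> S" using assms by auto
      ultimately have "{x, y} \<in> (F - {e \<in> E. e \<subseteq> C}) \<inter> bd {e \<in> E. e \<subseteq> S} C"
        unfolding bd_def by blast
      then show False using d by blast
    qed
  qed (auto simp: bd_def)
  show ?thesis unfolding R B
  proof (intro iffI conjI)
    assume eq: "cluster F S v = C"
    show cl: "\<forall>x\<in>C. \<forall>y\<in>S. {x, y} \<in> F \<longrightarrow> y \<in> C"
      using cluster_step[of _ F S v] eq assms by blast
    have "cluster F S v \<subseteq> cluster F C v"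
      using cl cluster_subset[OF assms(1), of F] by (intro cluster_closed) (auto intro: cluster_step)
    then show "cluster F C v = C" using eq cluster_subset[OF assms(1), of F] by auto
  next
    assume as: "cluster F C v = C \<and> (\<forall>x\<in>C. \<forall>y\<in>S. {x, y} \<in> F \<longrightarrow> y \<in> C)"
    then have "cluster F S v \<subseteq> C" using assms by (intro cluster_closed) auto
    moreover have "C \<subseteq> cluster F S v" using as cluster_mono[of F F C S v] assms by auto
    ultimately show "cluster F S v = C" by auto
  qed
qed

text \<open>Given a configuration that connects \<open>C\<close>, at most \<open>card C - 1\<close>
  of its edges already connect it, and these all survive the thinning with probability at least
  \<open>r ^ (card C - 1)\<close>.\<close>

lemma prob_connected_thin:
  assumes "finite E" "0 \<le> p" "p \<le> 1" "0 \<le> r" "r \<le> 1" "finite C" "v \<in> C"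
  shows "r ^ (card C - 1) * measure_pmf.prob (percolate E p) {F. cluster F C v = C} \<le>
    measure_pmf.prob (percolate E (p * r)) {F. cluster F C v = C}"
proof -
  have "r ^ (card C - 1) * measure_pmf.prob (percolate E p) {F. cluster F C v = C} =
      (\<integral>F. r ^ (card C - 1) * indicator {F. cluster F C v = C} F \<partial>measure_pmf (percolate E p))"
    by simp
  also have "\<dots> \<le> (\<integral>F. measure_pmf.prob (percolate E r) {R. cluster (F \<inter> R) C v = C} \<partial>measure_pmf (percolate E p))"
  proof (intro integral_mono_AE AE_pmfI)
    fix F assume F: "F \<in> set_pmf (percolate E p)"
    show "r ^ (card C - 1) * indicator {F. cluster F C v = C} F \<le>
      measure_pmf.prob (percolate E r) {R. cluster (F \<inter> R) C v = C}"
    proof (cases "cluster F C v = C")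
      case True
      obtain T where T: "T \<subseteq> F" "finite T" "card T < card C" "cluster T C v = C"
        using spanning_tree_exists[OF assms(6,7) True] by blast
      have "r ^ (card C - 1) \<le> r ^ card T" using T assms by (intro power_decreasing) auto
      also have "\<dots> = measure_pmf.prob (percolate E r) {R. T \<subseteq> R}"
        using T percolate_subset[OF F] assms by (intro percolate_prob_superset[symmetric]) auto
      also have "\<dots> \<le> measure_pmf.prob (percolate E r) {R. cluster (F \<inter> R) C v = C}"
      proof (intro measure_pmf.finite_measure_mono Collect_mono impI)
        fix R assume "T \<subseteq> R"
        then have "cluster T C v \<subseteq> cluster (F \<inter> R) C v" using T by (intro cluster_mono) auto
        then show "cluster (F \<inter> R) C v = C" using T cluster_subset[OF assms(7)] by blast
      qed auto
      finally show ?thesis using True by simp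
    qed simp
  qed (auto intro!: measure_pmf.integrable_const_bound[where B = 1] simp: power_le_one assms indicator_def)
  also have "\<dots> = measure_pmf.prob (percolate E (p * r)) {F. cluster F C v = C}"
    unfolding percolate_thin[OF assms(1-5)]
    using prob_pair[of "percolate E p" "percolate E r" "\<lambda>F R. cluster (F \<inter> R) C v = C"]
    by (simp add: vimage_def case_prod_beta')
  finally show ?thesis .
qed

lemma prob_cluster_eq:
  assumes "finite E" "0 \<le> p" "p \<le> 1" "v \<in> C" "C \<subseteq> S"
  shows "measure_pmf.prob (percolate E p) {F. cluster F S v = C} =
    measure_pmf.prob (percolate {e \<in> E. e \<subseteq> C} p) {F. cluster F C v = C} *
    (1 - p) ^ card (bd {e \<in> E. e \<subseteq> S} C)"
proof -
  let ?A = "{e \<in> E. e \<subseteq> C}" and ?B = "bd {e \<in> E. e \<subseteq> S} C"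
  have "measure_pmf.prob (percolate E p) {F. cluster F S v = C} =
      measure_pmf.prob (percolate E p) {F. cluster (F \<inter> ?A) C v = C \<and> (F - ?A) \<inter> ?B = {}}"
  proof (intro measure_pmf.finite_measure_eq_AE AE_pmfI)
    fix F assume "F \<in> set_pmf (percolate E p)"
    from cluster_eq_iff[OF assms(4,5) percolate_subset[OF this]]
    show "F \<in> {F. cluster F S v = C} \<longleftrightarrow> F \<in> {F. cluster (F \<inter> ?A) C v = C \<and> (F - ?A) \<inter> ?B = {}}"
      by simp
  qed auto
  also have "\<dots> = measure_pmf.prob (percolate ?A p) {F. cluster F C v = C} *
      measure_pmf.prob (percolate (E - ?A) p) {F. F \<inter> ?B = {}}"
    using assms(1) by (intro percolate_indep) auto
  also have "measure_pmf.prob (percolate (E - ?A) p) {F. F \<inter> ?B = {}} = (1 - p) ^ card ?B"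
  proof -
    have B: "?B \<subseteq> E - ?A" by (auto simp: bd_def)
    then have "finite ?B" using assms(1) finite_subset by blast
    then show ?thesis
      using percolate_restrict[of "E - ?A" ?B p "\<lambda>F. F = {}"] percolate_prob_empty[of ?B p] B assms
      by simp
  qed
  finally show ?thesis .
qed

text \<open>Thinning a configuration with rate \<open>r = 1 / (1 + \<eta>)\<close> keeps a spanning tree of a cluster of
  size \<open>k\<close> with probability at least \<open>r ^ (k - 1)\<close>, while it makes a large boundary more likely to be
  closed. With the given expansion the second effect dominates, so every small cluster is likelier
  in the thinned configuration by a factor of at least \<open>1 / r\<close>.\<close>

lemma prob_small_cluster_le:
  fixes d :: real
  assumes "finite E" "finite S" "v \<in> S" "0 \<le> p" "p \<le> 1" "0 < \<eta>" "p * d \<ge> 1 + \<eta>"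
    and expand: "\<And>C. \<lbrakk>v \<in> C; C \<subseteq> S; card C < s\<rbrakk> \<Longrightarrow> d * card C \<le> card (bd {e \<in> E. e \<subseteq> S} C)"
  shows "measure_pmf.prob (percolate E p) {F. card (cluster F S v) < s} \<le> 1 / (1 + \<eta>)"
proof -
  define r where "r = 1 / (1 + \<eta>)"
  have r: "0 < r" "r \<le> 1" using assms(6) by (auto simp: r_def)
  have q: "0 \<le> p * r" "p * r \<le> 1" "p * r \<le> p" using assms r by (auto intro: mult_le_one mult_left_le)
  have ratio: "measure_pmf.prob (percolate E p) {F. cluster F S v = C} \<le>
      r * measure_pmf.prob (percolate E (p * r)) {F. cluster F S v = C}"
    if C: "v \<in> C" "C \<subseteq> S" "card C < s" for C
  proof -
    define k where "k = card C"
    define b where "b = card (bd {e \<in> E. e \<subseteq> S} C)"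
    define A where "A = (\<lambda>q. measure_pmf.prob (percolate {e \<in> E. e \<subseteq> C} q) {F. cluster F C v = C})"
    have finC: "finite C" using C assms(2) finite_subset by blast
    have k: "k > 0" using C finC by (auto simp: k_def card_gt_0_iff)
    have 1: "r ^ (k - 1) * A p \<le> A (p * r)"
      unfolding A_def k_def using assms r C finC by (intro prob_connected_thin) auto
    have "(1 - p) ^ b \<le> ((1 - p * r) * exp (- (p - p * r))) ^ b"
    proof (intro power_mono)
      \<comment> \<open>The right side expands to \<open>1 - p\<close> plus the nonnegative term
        \<open>p * r * (p - p * r)\<close>.\<close>
      have "1 - p \<le> (1 - p * r) * (1 - (p - p * r))"
        using mult_nonneg_nonneg[OF q(1), of "p - p * r"] q by (simp add: algebra_simps)
      also have "\<dots> \<le> (1 - p * r) * exp (- (p - p * r))"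
        using exp_ge_add_one_self[of "- (p - p * r)"] q(2) by (intro mult_left_mono) linarith+
      finally show "1 - p \<le> (1 - p * r) * exp (- (p - p * r))" .
    qed (use assms in auto)
    also have "\<dots> = (1 - p * r) ^ b * exp (- (p - p * r) * b)"
      unfolding power_mult_distrib exp_of_nat2_mult ..
    also have "\<dots> \<le> (1 - p * r) ^ b * exp (- \<eta> * k)"
    proof (intro mult_left_mono)
      have "\<eta> * k = (1 - r) * (1 + \<eta>) * k" using assms(6) by (simp add: r_def field_simps)
      also have "\<dots> \<le> (1 - r) * (p * d) * k" using r assms by (intro mult_right_mono mult_left_mono) auto
      also have "\<dots> = (p - p * r) * (d * k)" by (simp add: algebra_simps)
      also have "\<dots> \<le> (p - p * r) * b" using expand[OF C] q by (intro mult_left_mono) (auto simp: b_def k_def)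
      finally show "exp (- (p - p * r) * b) \<le> exp (- \<eta> * k)"
        unfolding exp_le_cancel_iff mult_minus_left by linarith
    qed (use q in auto)
    also have "exp (- \<eta> * k) \<le> r ^ k"
    proof -
      have "(1 + \<eta>) ^ k \<le> exp \<eta> ^ k" using exp_ge_add_one_self[of \<eta>] assms(6) by (intro power_mono) auto
      then have "inverse (exp \<eta> ^ k) \<le> inverse ((1 + \<eta>) ^ k)" using assms(6) by (intro le_imp_inverse_le) auto
      moreover have "exp (- \<eta> * k) = inverse (exp \<eta> ^ k)"
        by (simp add: exp_minus exp_of_nat2_mult)
      moreover have "r ^ k = inverse ((1 + \<eta>) ^ k)" by (simp add: r_def power_one_over inverse_eq_divide)
      ultimately show ?thesis by simp
    qed
    finally have 2: "(1 - p) ^ b \<le> (1 - p * r) ^ b * r ^ k" using q by (simp add: mult_left_mono)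
    have "A p * (1 - p) ^ b \<le> A p * ((1 - p * r) ^ b * r ^ k)"
      using 2 by (intro mult_left_mono) (auto simp: A_def)
    \<comment> \<open>The boundary gains \<open>r ^ k\<close> while connectivity costs only
      \<open>r ^ (k - 1)\<close>, so exactly one factor \<open>r\<close> remains.\<close>
    also have "\<dots> = r * (r ^ (k - 1) * A p) * (1 - p * r) ^ b"
      using k by (cases k) (auto simp: algebra_simps)
    also have "\<dots> \<le> r * A (p * r) * (1 - p * r) ^ b"
      using 1 r q by (intro mult_right_mono mult_left_mono) auto
    finally show ?thesis
      using prob_cluster_eq[OF assms(1) _ _ C(1,2), of p] prob_cluster_eq[OF assms(1) _ _ C(1,2), of "p * r"]
        assms q by (simp add: A_def b_def)
  qed
  let ?C = "{C. v \<in> C \<and> C \<subseteq> S \<and> card C < s}"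
  have fin: "finite ?C" using assms(2) by (auto intro: finite_subset[of _ "Pow S"])
  have un: "measure_pmf.prob M (\<Union>C\<in>?C. {F. cluster F S v = C}) =
      (\<Sum>C\<in>?C. measure_pmf.prob M {F. cluster F S v = C})" for M
    using fin by (intro measure_pmf.finite_measure_finite_Union) (auto simp: disjoint_family_on_def)
  have "{F. card (cluster F S v) < s} = (\<Union>C\<in>?C. {F. cluster F S v = C})"
    using cluster_subset[OF assms(3)] by auto
  then have "measure_pmf.prob (percolate E p) {F. card (cluster F S v) < s} =
      (\<Sum>C\<in>?C. measure_pmf.prob (percolate E p) {F. cluster F S v = C})"
    by (simp only: un)
  also have "\<dots> \<le> (\<Sum>C\<in>?C. r * measure_pmf.prob (percolate E (p * r)) {F. cluster F S v = C})"
    by (intro sum_mono ratio) auto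
  also have "\<dots> = r * (\<Sum>C\<in>?C. measure_pmf.prob (percolate E (p * r)) {F. cluster F S v = C})"
    by (simp add: sum_distrib_left)
  also have "\<dots> = r * measure_pmf.prob (percolate E (p * r)) (\<Union>C\<in>?C. {F. cluster F S v = C})"
    by (simp only: un)
  \<comment> \<open>The disjoint events for the different \<open>C\<close> have total probability at
    most 1 in the thinned configuration.\<close>
  also have "\<dots> \<le> r" using r by (simp add: mult_left_le)
  finally show ?thesis by (simp add: r_def)
qed

section \<open>Separators in graphs without long cycles\<close>

lemma is_cycleI:
  assumes "3 \<le> length c" "distinct c" "set c \<subseteq> V" "successively (\<lambda>x y. {x, y} \<in> F) c"
    "{last c, hd c} \<in> F"
  shows "is_cycle (V, F) c"
  unfolding is_cycle_def verts_def edges_def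
proof (intro conjI allI impI)
  fix i assume i: "i < length c"
  show "{c ! i, c ! (Suc i mod length c)} \<in> snd (V, F)"
  proof (cases "Suc i < length c")
    case True
    then show ?thesis using assms(4) by (simp add: successively_conv_nth)
  next
    case False
    then have "i = length c - 1" "Suc i = length c" using i by auto
    then show ?thesis using assms(1,5) by (metis hd_conv_nth last_conv_nth list.size(3) mod_self not_numeral_le_zero snd_conv)
  qed
qed (use assms in auto)

lemma cluster_path:
  assumes "w \<in> cluster F S v"
  shows "\<exists>xs. xs \<noteq> [] \<and> hd xs = v \<and> last xs = w \<and> distinct xs \<and> set xs \<subseteq> insert v S \<and>
    successively (\<lambda>x y. {x, y} \<in> F) xs"
proof -
  from assms have "(v, w) \<in> (adj F S)\<^sup>*" by (simp add: cluster_def)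
  then show ?thesis
  proof (induction rule: rtrancl_induct)
    case base
    then show ?case by (intro exI[of _ "[v]"]) auto
  next
    case (step y z)
    then obtain xs where xs: "xs \<noteq> []" "hd xs = v" "last xs = y" "distinct xs" "set xs \<subseteq> insert v S"
      "successively (\<lambda>x y. {x, y} \<in> F) xs" by blast
    show ?case
    proof (cases "z \<in> set xs")
      \<comment> \<open>The walk returns to the path built so far, which is cut at
        \<open>z\<close>.\<close>
      case True
      then obtain ys zs where "xs = ys @ z # zs" by (metis split_list)
      then have "xs = (ys @ [z]) @ zs" by simp
      then show ?thesis using xs by (intro exI[of _ "ys @ [z]"]) (auto simp: successively_append_iff hd_append)
    next
      case False
      then show ?thesis using xs step(2)
        by (intro exI[of _ "xs @ [z]"]) (auto simp: successively_append_iff adj_def)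
    qed
  qed
qed

lemma cluster_cluster:
  assumes "v \<in> S" "x \<in> cluster F S v"
  shows "cluster F (cluster F S v) x = cluster F S v"
proof
  show "cluster F (cluster F S v) x \<subseteq> cluster F S v" using assms by (intro cluster_subset)
  have "cluster F S x \<subseteq> cluster F (cluster F S v) x"
  proof (rule cluster_closed)
    fix y z assume *: "y \<in> cluster F (cluster F S v) x" "y \<in> S" "z \<in> S" "{y, z} \<in> F"
    then have y: "y \<in> cluster F S v" using cluster_subset[OF assms(2)] by blast
    have "z \<in> cluster F S v" by (rule cluster_step[OF y *(2-4)])
    with y *(1,4) show "z \<in> cluster F (cluster F S v) x" by (metis cluster_step)
  qed simp
  then show "cluster F S v \<subseteq> cluster F (cluster F S v) x" using cluster_eq[OF assms(2)] by simp
qed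

text \<open>Walk into the graph along a path \<open>U\<close>, always entering the part \<open>K\<close> that contains more than half
  of \<open>W\<close>. When no such part remains, the vertices of \<open>U\<close> adjacent to \<open>K\<close> lie among the last \<open>L - 2\<close>
  ones, since otherwise a long cycle could be closed through \<open>K\<close>.\<close>

lemma halving_separator_exists:
  assumes "finite V" and FV: "\<And>x y. {x, y} \<in> F \<Longrightarrow> x \<in> V \<and> y \<in> V" and "3 \<le> L"
    and no_cycle: "\<And>c. is_cycle (V, F) c \<Longrightarrow> length c < L" and "finite W"
  shows "\<exists>X \<subseteq> V. card X \<le> L \<and> (\<forall>v \<in> V - X. 2 * card (cluster F (V - X) v \<inter> W) \<le> card W)"
proof -
  \<comment> \<open>\<open>U\<close> lists the walk backwards, newest vertex first, so that one more
    step is a Cons. \<open>K\<close> is a connected region with more than half of \<open>W\<close>;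
    edges leave it only towards \<open>U\<close>, and \<open>hd U\<close> touches it.\<close>
  define good where "good = (\<lambda>U K. distinct U \<and> set U \<subseteq> V \<and> K \<subseteq> V \<and> K \<noteq> {} \<and> set U \<inter> K = {} \<and>
    successively (\<lambda>x y. {x, y} \<in> F) U \<and> (\<forall>x\<in>K. cluster F K x = K) \<and>
    (\<forall>x\<in>K. \<forall>y. {x, y} \<in> F \<longrightarrow> y \<in> K \<union> set U) \<and> (U \<noteq> [] \<longrightarrow> (\<exists>y\<in>K. {hd U, y} \<in> F)) \<and>
    card W < 2 * card (K \<inter> W))"
  show ?thesis
  proof (cases "\<exists>U K. good U K")
    case False
    have "2 * card (cluster F V v \<inter> W) \<le> card W" if v: "v \<in> V" for v
    proof (rule ccontr)
      assume "\<not> ?thesis"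
      then have "good [] (cluster F V v)"
        using v cluster_subset[OF v, of F] cluster_cluster[OF v] FV cluster_step[of _ F V v]
        unfolding good_def by auto
      then show False using False by blast
    qed
    then show ?thesis by (intro exI[of _ "{}"]) auto
  next
    case True
    then obtain n where "\<exists>U K. good U K \<and> card K = n" by blast
    \<comment> \<open>A smallest \<open>K\<close> replaces the iteration: one more step into a heavy
      part would shrink it.\<close>
    define n0 where "n0 = (LEAST n. \<exists>U K. good U K \<and> card K = n)"
    obtain U K where UK: "good U K" "card K = n0"
      using LeastI[of "\<lambda>n. \<exists>U K. good U K \<and> card K = n", OF \<open>\<exists>U K. good U K \<and> card K = n\<close>]
      unfolding n0_def by blast
    have least: "card K \<le> card K'" if "good U' K'" for U' K'
      unfolding UK(2) n0_def using that by (intro Least_le) blast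
    note g = UK(1)[unfolded good_def]
    obtain v where v: "v \<in> K" "U \<noteq> [] \<longrightarrow> {hd U, v} \<in> F" using g by blast
    \<comment> \<open>Deleting the next vertex \<open>v\<close> of the walk splits \<open>K\<close>
      into light parts; deleting the neighbours of \<open>K\<close> on \<open>U\<close> cuts
      \<open>K\<close> off from everything else.\<close>
    define X where "X = insert v {u \<in> set U. \<exists>y\<in>K. {u, y} \<in> F}"
    have finK: "finite K" using g assms(1) finite_subset by blast
    have "{u \<in> set U. \<exists>y\<in>K. {u, y} \<in> F} \<subseteq> set (take (L - 2) U)"
    proof
      fix u assume "u \<in> {u \<in> set U. \<exists>y\<in>K. {u, y} \<in> F}"
      then obtain i y where i: "i < length U" "u = U ! i" and y: "y \<in> K" "{u, y} \<in> F"
        by (auto simp: in_set_conv_nth)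
      have "i < L - 2"
      proof (rule ccontr)
        assume "\<not> i < L - 2"
        then have iL: "L \<le> i + 2" by auto
        have "v \<in> cluster F K y" using g y v by blast
        then obtain ys where ys: "ys \<noteq> []" "hd ys = y" "last ys = v" "distinct ys" "set ys \<subseteq> insert y K"
          "successively (\<lambda>x y. {x, y} \<in> F) ys" using cluster_path by metis
        \<comment> \<open>The cycle runs from \<open>y\<close> through \<open>K\<close> to
          \<open>v\<close>, then along \<open>U\<close> from its head to \<open>u\<close>, and back
          to \<open>y\<close>. It has at least one vertex in \<open>K\<close> and
          \<open>i + 1\<close> on \<open>U\<close>.\<close>
        let ?c = "ys @ take (Suc i) U"
        have U: "U \<noteq> []" using i by auto
        have sub: "set (take (Suc i) U) \<subseteq> set U" by (rule set_take_subset)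
        have len: "length ?c \<ge> i + 2" using i ys(1) by (cases ys) auto
        have lst: "last (take (Suc i) U) = u" using i by (simp add: take_Suc_conv_app_nth)
        have "successively (\<lambda>x y. {x, y} \<in> F) (take (Suc i) U @ drop (Suc i) U)" using g by simp
        then have "successively (\<lambda>x y. {x, y} \<in> F) (take (Suc i) U)"
          unfolding successively_append_iff by blast
        then have "successively (\<lambda>x y. {x, y} \<in> F) ?c"
          using ys U v by (auto simp: successively_append_iff insert_commute)
        moreover have "distinct ?c" using ys g sub y(1) by auto
        moreover have "set ?c \<subseteq> V" using ys g sub y(1) by auto
        moreover have "{last ?c, hd ?c} \<in> F" using ys y U lst by simp
        ultimately have "is_cycle (V, F) ?c" using len iL assms(3) by (intro is_cycleI) auto
        then show False using no_cycle[of ?c] len iL by simp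
      qed
      then show "u \<in> set (take (L - 2) U)" using i by (auto simp: in_set_conv_nth intro!: exI[of _ i])
    qed
    then have "card {u \<in> set U. \<exists>y\<in>K. {u, y} \<in> F} \<le> card (set (take (L - 2) U))"
      by (intro card_mono) auto
    also have "\<dots> \<le> L - 2" using card_length[of "take (L - 2) U"] by simp
    finally have "card X \<le> L" using assms(3) unfolding X_def by (auto simp: card_insert_if)
    moreover have "X \<subseteq> V" using g v unfolding X_def by auto
    moreover have "2 * card (cluster F (V - X) w \<inter> W) \<le> card W" if w: "w \<in> V - X" for w
    proof (cases "w \<in> K")
      case True
      let ?K = "cluster F (K - {v}) w"
      have w': "w \<in> K - {v}" using True w by (auto simp: X_def)
      have K': "?K \<subseteq> K - {v}" using w' by (rule cluster_subset)
      have nb: "y \<in> K - {v}" if "x \<in> K" "{x, y} \<in> F" "y \<in> V - X" for x y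
        using g that by (auto simp: X_def insert_commute)
      have sub: "cluster F (V - X) w \<subseteq> ?K"
      proof (rule cluster_closed)
        fix x y assume *: "x \<in> ?K" "x \<in> V - X" "y \<in> V - X" "{x, y} \<in> F"
        then have "y \<in> K - {v}" using nb[of x y] K' by blast
        moreover have "x \<in> K - {v}" using * K' by blast
        ultimately show "y \<in> ?K" using cluster_step[OF *(1)] *(4) by simp
      qed simp
      \<comment> \<open>As \<open>K\<close> is connected, every part left after deleting
        \<open>v\<close> touches \<open>v\<close>, so the walk could go on from \<open>v\<close>
        into \<open>?K\<close>.\<close>
      have "\<exists>y\<in>?K. {v, y} \<in> F"
      proof (rule ccontr)
        assume no: "\<not> ?thesis"
        have "cluster F K w \<subseteq> ?K"
        proof (rule cluster_closed)
          fix x y assume *: "x \<in> ?K" "x \<in> K" "y \<in> K" "{x, y} \<in> F"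
          then have "y \<noteq> v" using no by (auto simp: insert_commute)
          moreover have "x \<in> K - {v}" using * K' by blast
          ultimately show "y \<in> ?K" using cluster_step[OF *(1)] *(3,4) by simp
        qed simp
        then show False using g True v K' by blast
      qed
      moreover have "\<forall>x\<in>?K. \<forall>y. {x, y} \<in> F \<longrightarrow> y \<in> ?K \<union> set (v # U)"
      proof (intro ballI allI impI)
        fix x y assume *: "x \<in> ?K" "{x, y} \<in> F"
        then have "y \<in> K \<union> set U" using g K' by blast
        moreover have "x \<in> K - {v}" using * K' by blast
        ultimately show "y \<in> ?K \<union> set (v # U)"
          using * cluster_step[of x F "K - {v}" w y] by auto
      qed
      moreover have "successively (\<lambda>x y. {x, y} \<in> F) (v # U)"
        using g v by (cases U) (auto simp: insert_commute)
      moreover have "\<forall>x\<in>?K. cluster F ?K x = ?K" using cluster_cluster[OF w'] by blast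
      moreover have "distinct (v # U)" "set (v # U) \<subseteq> V" "?K \<subseteq> V" "?K \<noteq> {}" "set (v # U) \<inter> ?K = {}"
      proof -
        have "distinct U" "set U \<subseteq> V" "K \<subseteq> V" "set U \<inter> K = {}" using g by - (elim conjE; assumption)+
        then show "distinct (v # U)" "set (v # U) \<subseteq> V" "?K \<subseteq> V" "?K \<noteq> {}" "set (v # U) \<inter> ?K = {}"
          using v(1) K' by (auto simp del: cluster_refl) (use cluster_refl[of w F "K - {v}"] in blast)
      qed
      ultimately have "good (v # U) ?K" if "card W < 2 * card (?K \<inter> W)"
        using that unfolding good_def list.sel by - (intro conjI impI; assumption)
      moreover have "card ?K < card K" using K' v finK by (intro psubset_card_mono) auto
      ultimately have "2 * card (?K \<inter> W) \<le> card W" using least by (meson not_le)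
      moreover have "card (cluster F (V - X) w \<inter> W) \<le> card (?K \<inter> W)"
        using sub K' finK by (intro card_mono) (auto intro: finite_subset)
      ultimately show ?thesis by linarith
    next
      case False
      \<comment> \<open>Every neighbour of \<open>K\<close> outside \<open>K\<close> lies on
        \<open>U\<close>, hence in \<open>X\<close>, so \<open>K\<close> cannot be entered from
        outside; less than half of \<open>W\<close> lies outside \<open>K\<close>.\<close>
      have "cluster F (V - X) w \<subseteq> - K"
      proof (rule cluster_closed)
        fix x y assume *: "x \<in> - K" "x \<in> V - X" "y \<in> V - X" "{x, y} \<in> F"
        show "y \<in> - K"
        proof
          assume y: "y \<in> K"
          moreover have "{y, x} \<in> F" using * by (simp add: insert_commute)
          ultimately have "x \<in> set U" using g * by blast
          then show False using * y by (auto simp: X_def)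
        qed
      qed (use False in simp)
      then have "cluster F (V - X) w \<inter> W \<subseteq> W - K \<inter> W" by auto
      then have "card (cluster F (V - X) w \<inter> W) \<le> card (W - K \<inter> W)"
        using \<open>finite W\<close> by (intro card_mono) auto
      also have "\<dots> = card W - card (K \<inter> W)" using \<open>finite W\<close> by (intro card_Diff_subset) auto
      finally show ?thesis using g by linarith
    qed
    ultimately show ?thesis by blast
  qed
qed

text \<open>Among unions of parts of \<open>V - X\<close> with at most half of \<open>W\<close>,
  take one that is largest on \<open>W\<close>. If it fell below a quarter by more than
  \<open>L\<close>, a further part meeting \<open>W\<close>, which by maximality is no larger on
  \<open>W\<close>, could be added.\<close>

lemma balanced_separation_exists:
  assumes "finite V" and FV: "\<And>x y. {x, y} \<in> F \<Longrightarrow> x \<in> V \<and> y \<in> V" and "3 \<le> L" and "W \<subseteq> V"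
    and no_cycle: "\<And>c. is_cycle (V, F) c \<Longrightarrow> length c < L"
  shows "\<exists>X A. X \<subseteq> V \<and> A \<subseteq> V - X \<and> card X \<le> L \<and> (\<forall>x\<in>A. \<forall>y\<in>V - X - A. {x, y} \<notin> F) \<and>
    card W \<le> 4 * card (A \<inter> W) + 4 * L \<and> card W \<le> 4 * card ((V - X - A) \<inter> W) + 4 * L"
proof -
  have finW: "finite W" using assms(1,4) finite_subset by blast
  have "\<exists>X \<subseteq> V. card X \<le> L \<and> (\<forall>v \<in> V - X. 2 * card (cluster F (V - X) v \<inter> W) \<le> card W)"
    by (rule halving_separator_exists) (fact assms finW | erule assms)+
  then obtain X where X: "X \<subseteq> V" "card X \<le> L"
    "\<forall>v \<in> V - X. 2 * card (cluster F (V - X) v \<inter> W) \<le> card W" by blast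
  define ok where "ok = (\<lambda>A. A \<subseteq> V - X \<and> (\<forall>x\<in>A. \<forall>y\<in>V - X - A. {x, y} \<notin> F) \<and> 2 * card (A \<inter> W) \<le> card W)"
  have "ok {}" by (simp add: ok_def)
  moreover have "card (A \<inter> W) < Suc (card W)" for A using finW by (simp add: card_mono le_imp_less_Suc)
  ultimately obtain A where A: "ok A" and max: "\<And>A'. ok A' \<Longrightarrow> card (A' \<inter> W) \<le> card (A \<inter> W)"
    using ex_has_greatest_nat[of ok "{}" "\<lambda>A. card (A \<inter> W)" "Suc (card W)"] by blast
  let ?B = "V - X - A"
  have A': "A \<subseteq> V - X" "\<forall>x\<in>A. \<forall>y\<in>?B. {x, y} \<notin> F" "2 * card (A \<inter> W) \<le> card W"
    using A by (auto simp: ok_def)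
  have "card W \<le> card ((X \<inter> W) \<union> ((A \<inter> W) \<union> (?B \<inter> W)))"
    using assms(4) finW by (intro card_mono) auto
  also have "\<dots> \<le> card (X \<inter> W) + (card (A \<inter> W) + card (?B \<inter> W))"
    by (meson card_Un_le add_left_mono le_trans)
  also have "card (X \<inter> W) \<le> L"
    using X assms(1) by (meson card_mono finite_subset inf_le1 le_trans)
  finally have W: "card W \<le> L + card (A \<inter> W) + card (?B \<inter> W)" by simp
  have "card W \<le> 4 * card (A \<inter> W) + 4 * L"
  proof (rule ccontr)
    assume small: "\<not> ?thesis"
    then have "card (?B \<inter> W) > 0" using W by linarith
    then obtain b where b: "b \<in> ?B" "b \<in> W" by (auto simp: card_gt_0_iff)
    let ?D = "cluster F (V - X) b"
    have bV: "b \<in> V - X" using b by auto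
    have sub: "?D \<subseteq> V - X" using bV by (rule cluster_subset)
    have "?D \<subseteq> ?B"
    proof (rule cluster_closed)
      fix x y assume *: "x \<in> ?B" "x \<in> V - X" "y \<in> V - X" "{x, y} \<in> F"
      then have "{y, x} \<in> F" by (simp add: insert_commute)
      then show "y \<in> ?B" using * A'(2) by blast
    qed (rule b(1))
    have Dcl: "\<forall>x\<in>?D. \<forall>y\<in>V - X - ?D. {x, y} \<notin> F"
    proof (intro ballI notI)
      fix x y assume *: "x \<in> ?D" "y \<in> V - X - ?D" "{x, y} \<in> F"
      then have "y \<in> ?D" using sub cluster_step[OF *(1), of y] by auto
      then show False using * by blast
    qed
    have okD: "ok ?D" using sub Dcl X(3) bV by (auto simp: ok_def)
    have card: "card ((A \<union> ?D) \<inter> W) = card (A \<inter> W) + card (?D \<inter> W)"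
      unfolding Int_Un_distrib2 using \<open>?D \<subseteq> ?B\<close> finW by (intro card_Un_disjoint) auto
    have "ok (A \<union> ?D)"
      using A' sub Dcl max[OF okD] small card unfolding ok_def by auto
    then have "card (?D \<inter> W) = 0" using max card by fastforce
    moreover have "b \<in> ?D \<inter> W" using b by simp
    ultimately show False using finW by (metis card_0_eq empty_iff finite_Int)
  qed
  moreover have "card W \<le> 4 * card (?B \<inter> W) + 4 * L" using W A'(3) by linarith
  ultimately show ?thesis using X(1,2) A'(1,2) by blast
qed

section \<open>Edge isoperimetry in the hypercube\<close>

abbreviation cubeV :: "nat \<Rightarrow> (nat \<Rightarrow> nat) set" where
  "cubeV m \<equiv> verts (hypercube m)"

abbreviation cubeE :: "nat \<Rightarrow> (nat \<Rightarrow> nat) set set" where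
  "cubeE m \<equiv> edges (hypercube m)"

text \<open>Truncated subtraction makes this a bit complement only for the values 0 and 1, which is
  why the facts about it assume a vertex of the cube.\<close>

definition flip :: "nat \<Rightarrow> (nat \<Rightarrow> nat) \<Rightarrow> nat \<Rightarrow> nat" where
  "flip i x = x(i := 1 - x i)"

lemma cubeV_eq: "cubeV m = {..<m} \<rightarrow>\<^sub>E {0, 1}"
  by (simp add: hypercube_def Let_def verts_def)

lemma finite_cubeV [simp]: "finite (cubeV m)"
  by (simp add: cubeV_eq finite_PiE)

lemma card_cubeV [simp]: "card (cubeV m) = 2 ^ m"
  by (simp add: cubeV_eq card_PiE numeral_2_eq_2)

lemma flip_in_cubeV:
  assumes "x \<in> cubeV m" "i < m"
  shows "flip i x \<in> cubeV m"
  using assms by (auto simp: cubeV_eq flip_def PiE_iff extensional_def)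

lemma flip_neq:
  assumes "x \<in> cubeV m" "i < m"
  shows "flip i x i \<noteq> x i"
proof -
  have "x i \<in> {0, 1}" using assms by (auto simp: cubeV_eq PiE_iff)
  then show ?thesis by (auto simp: flip_def)
qed

lemma flip_flip:
  assumes "x \<in> cubeV m" "i < m"
  shows "flip i (flip i x) = x"
proof -
  have "x i \<in> {0, 1}" using assms by (auto simp: cubeV_eq PiE_iff)
  then show ?thesis by (auto simp: flip_def)
qed

lemma flip_inj_index:
  assumes "x \<in> cubeV m" "i < m" "j < m" "flip i x = flip j x"
  shows "i = j"
  using flip_neq[OF assms(1,2)] assms(4) by (metis flip_def fun_upd_other)

lemma cubeE_iff:
  "e \<in> cubeE m \<longleftrightarrow> (\<exists>x i. x \<in> cubeV m \<and> i < m \<and> e = {x, flip i x})"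
proof
  assume "e \<in> cubeE m"
  then obtain x y where xy: "e = {x, y}" "x \<in> cubeV m" "y \<in> cubeV m" "card {i \<in> {..<m}. x i \<noteq> y i} = 1"
    by (auto simp: hypercube_def Let_def edges_def verts_def)
  then obtain i where i: "{i \<in> {..<m}. x i \<noteq> y i} = {i}" by (auto simp: card_1_singleton_iff)
  have "y j = flip i x j" for j
  proof (cases "j < m")
    case True
    have "x j \<in> {0, 1}" "y j \<in> {0, 1}" using xy True by (auto simp: cubeV_eq PiE_iff)
    moreover have "x j \<noteq> y j \<longleftrightarrow> j = i" using i True by auto
    ultimately show ?thesis by (auto simp: flip_def)
  next
    case False
    then show ?thesis using xy i by (auto simp: cubeV_eq PiE_iff extensional_def flip_def)
  qed
  then have "y = flip i x" by blast
  then show "\<exists>x i. x \<in> cubeV m \<and> i < m \<and> e = {x, flip i x}" using xy i by blast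
next
  assume "\<exists>x i. x \<in> cubeV m \<and> i < m \<and> e = {x, flip i x}"
  then obtain x i where xi: "x \<in> cubeV m" "i < m" "e = {x, flip i x}" by blast
  have "{j \<in> {..<m}. x j \<noteq> flip i x j} = {i}"
    using flip_neq[OF xi(1,2)] xi(2) by (auto simp: flip_def split: if_splits)
  then have "card {j \<in> {..<m}. x j \<noteq> flip i x j} = 1" by simp
  then show "e \<in> cubeE m" using xi flip_in_cubeV[OF xi(1,2)]
    by (auto simp: hypercube_def Let_def edges_def verts_def)
qed

lemma cube_edge:
  assumes "{x, y} \<in> cubeE m"
  shows "x \<in> cubeV m" "y \<in> cubeV m" "x \<noteq> y" "\<exists>i<m. y = flip i x"
proof -
  obtain z i where z: "z \<in> cubeV m" "i < m" "{x, y} = {z, flip i z}" using assms cubeE_iff by blast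
  then show "x \<in> cubeV m" "y \<in> cubeV m" "x \<noteq> y" "\<exists>i<m. y = flip i x"
    using flip_in_cubeV[OF z(1,2)] flip_neq[OF z(1,2)] flip_flip[OF z(1,2)]
    by (auto simp: doubleton_eq_iff)
qed

lemma cubeE_subset: "e \<in> cubeE m \<Longrightarrow> e \<subseteq> cubeV m"
  using cubeE_iff flip_in_cubeV by fastforce

lemma finite_cubeE [simp]: "finite (cubeE m)"
  by (rule finite_subset[of _ "Pow (cubeV m)"]) (auto dest: cubeE_subset)

lemma card_cube_nbrs: "card {y. {x, y} \<in> cubeE m} \<le> m"
proof -
  have "{y. {x, y} \<in> cubeE m} \<subseteq> (\<lambda>i. flip i x) ` {..<m}" using cube_edge(4)[of x _ m] by auto
  then have "card {y. {x, y} \<in> cubeE m} \<le> card ((\<lambda>i. flip i x) ` {..<m})" by (intro card_mono) auto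
  also have "\<dots> \<le> m" using card_image_le[of "{..<m}" "\<lambda>i. flip i x"] by simp
  finally show ?thesis .
qed

section \<open>Edges inside a subset of the cube\<close>

lemma xlnx_superadditive:
  fixes a b :: real
  assumes "0 < a" "a \<le> b"
  shows "a * log 2 a + b * log 2 b + 2 * a \<le> (a + b) * log 2 (a + b)"
proof -
  \<comment> \<open>The derivative \<open>ln (a + t) - ln t\<close> is nonnegative, and
    \<open>?g a = a * ln a + 2 * a * ln 2\<close> turns \<open>?g a \<le> ?g b\<close> into the
    claim up to the base of the logarithm.\<close>
  let ?g = "\<lambda>t. (a + t) * ln (a + t) - t * ln t"
  have "?g a \<le> ?g b"
  proof (rule DERIV_nonneg_imp_nondecreasing[OF assms(2)])
    fix t assume t: "a \<le> t" "t \<le> b"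
    then have "(?g has_real_derivative ln (a + t) - ln t) (at t)"
      using assms by (auto intro!: derivative_eq_intros simp: add_pos_pos)
    moreover have "ln (a + t) - ln t \<ge> 0" using t assms by simp
    ultimately show "\<exists>y. (?g has_real_derivative y) (at t) \<and> 0 \<le> y" by blast
  qed
  moreover have "ln (a + a) = ln 2 + ln a" using assms ln_mult[of 2 a] by simp
  ultimately have "a * ln a + b * ln b + 2 * a * ln 2 \<le> (a + b) * ln (a + b)"
    by (simp add: algebra_simps)
  then have "(a * ln a + b * ln b + 2 * a * ln 2) / ln 2 \<le> (a + b) * ln (a + b) / ln 2"
    by (intro divide_right_mono) auto
  then show ?thesis by (simp add: log_def add_divide_distrib)
qed

text \<open>Splitting \<open>S\<close> by the bit \<open>a\<close> leaves flips in the other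
  directions inside the two halves, while flips of \<open>a\<close> match vertices of one half with
  vertices of the other; \<open>xlnx_superadditive\<close> absorbs these. Each internal edge is
  counted from both ends, so there is no factor 1/2.\<close>

lemma card_internal_flips_le:
  assumes "finite I" "finite S" "I \<subseteq> {..<m}" "S \<subseteq> cubeV m"
  shows "real (card {(x, i). x \<in> S \<and> i \<in> I \<and> flip i x \<in> S}) \<le> card S * log 2 (card S)"
  using assms
proof (induction I arbitrary: S rule: finite_induct)
  case empty
  then show ?case by (cases "card S") (auto simp: zero_le_log_cancel_iff)
next
  case (insert a I)
  let ?D = "\<lambda>S I. {(x, i). x \<in> S \<and> i \<in> I \<and> flip i x \<in> S}"
  define T where "T = (\<lambda>b. {x \<in> S. x a = b})"
  have am: "a < m" using insert.prems by auto
  have val: "x a = 0 \<or> x a = 1" if "x \<in> S" for x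
    using that insert.prems am by (auto simp: cubeV_eq PiE_iff)
  have S: "S = T 0 \<union> T 1" "T 0 \<inter> T 1 = {}" using val by (auto simp: T_def)
  have finT: "finite (T b)" for b using insert.prems by (auto simp: T_def)
  have finD: "finite (?D S' I')" if "finite S'" "finite I'" for S' I'
    by (rule finite_subset[of _ "S' \<times> I'"]) (use that in auto)
  have cardS: "card S = card (T 0) + card (T 1)" using S finT by (metis card_Un_disjoint)
  have IH: "real (card (?D (T b) I)) \<le> card (T b) * log 2 (card (T b))" for b
    using insert by (intro insert.IH) (auto simp: T_def)
  \<comment> \<open>For \<open>b\<close> equal to 0 or 1, these are the flips of \<open>a\<close>
    from the half \<open>T b\<close> into the opposite one.\<close>
  define J where "J = (\<lambda>b. (\<lambda>x. (x, a)) ` {x \<in> T b. flip a x \<in> T (1 - b)})"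
  have sub: "?D S (insert a I) \<subseteq> (?D (T 0) I \<union> ?D (T 1) I) \<union> (J 0 \<union> J 1)"
  proof
    fix q assume "q \<in> ?D S (insert a I)"
    then obtain x i where q: "q = (x, i)" "x \<in> S" "i \<in> insert a I" "flip i x \<in> S" by auto
    show "q \<in> (?D (T 0) I \<union> ?D (T 1) I) \<union> (J 0 \<union> J 1)"
    proof (cases "i = a")
      case True
      then show ?thesis using q val[OF q(2)] by (auto simp: J_def T_def flip_def)
    next
      case False
      then have "flip i x a = x a" by (simp add: flip_def)
      then show ?thesis using q False val[OF q(2)] by (auto simp: T_def)
    qed
  qed
  have J: "card (J b) \<le> card (T 0) \<and> card (J b) \<le> card (T 1)" if b: "b \<in> {0, 1}" for b
  proof -
    have 1: "card (J b) \<le> card {x \<in> T b. flip a x \<in> T (1 - b)}"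
      unfolding J_def using finT by (intro card_image_le) auto
    also have "\<dots> \<le> card (T b)" using finT by (intro card_mono) auto
    finally have 2: "card (J b) \<le> card (T b)" .
    have "inj_on (flip a) {x \<in> T b. flip a x \<in> T (1 - b)}"
    proof (rule inj_on_inverseI)
      fix x assume "x \<in> {x \<in> T b. flip a x \<in> T (1 - b)}"
      then show "flip a (flip a x) = x" using insert.prems am by (intro flip_flip) (auto simp: T_def)
    qed
    then have "card {x \<in> T b. flip a x \<in> T (1 - b)} \<le> card (T (1 - b))"
      using finT by (intro card_inj_on_le) auto
    then have "card (J b) \<le> card (T (1 - b))" using 1 by linarith
    with 2 b show ?thesis by auto
  qed
  have fin2: "finite (?D (T 0) I)" "finite (?D (T 1) I)" "finite (J 0)" "finite (J 1)"
    using finD finT insert.hyps by (auto simp: J_def)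
  have "card (?D S (insert a I)) \<le> card ((?D (T 0) I \<union> ?D (T 1) I) \<union> (J 0 \<union> J 1))"
    using sub fin2 by (intro card_mono) blast+
  also have "\<dots> \<le> (card (?D (T 0) I) + card (?D (T 1) I)) + (card (J 0) + card (J 1))"
    by (meson card_Un_le add_mono le_trans)
  finally have "real (card (?D S (insert a I))) \<le>
      card (T 0) * log 2 (card (T 0)) + card (T 1) * log 2 (card (T 1)) + (card (J 0) + card (J 1))"
    using IH[of 0] IH[of 1] by linarith
  also have "\<dots> \<le> card S * log 2 (card S)"
  proof -
    define s t where "s = real (card (T 0))" and "t = real (card (T 1))"
    have j: "card (J 0) + card (J 1) \<le> 2 * min s t" using J[of 0] J[of 1] by (auto simp: s_def t_def)
    have cs: "real (card S) = s + t" using cardS by (simp add: s_def t_def)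
    have "0 \<le> s" "0 \<le> t" by (auto simp: s_def t_def)
    then consider "s = 0" | "t = 0" | "0 < s" "s \<le> t" | "0 < t" "t \<le> s" by linarith
    then have "s * log 2 s + t * log 2 t + 2 * min s t \<le> (s + t) * log 2 (s + t)"
    proof cases
      case 3
      then show ?thesis using xlnx_superadditive[of s t] by simp
    next
      case 4
      then show ?thesis using xlnx_superadditive[of t s] by (simp add: add.commute)
    qed (use \<open>0 \<le> s\<close> \<open>0 \<le> t\<close> in \<open>auto\<close>)
    then show ?thesis using j unfolding cs s_def[symmetric] t_def[symmetric] by linarith
  qed
  finally show ?case .
qed

definition subcube :: "nat \<Rightarrow> nat \<Rightarrow> (nat \<Rightarrow> nat) \<Rightarrow> (nat \<Rightarrow> nat) set" where
  "subcube m K v = {x \<in> cubeV m. \<forall>j<K. x j = v j}"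

text \<open>Of the \<open>m - K\<close> free directions at a vertex of \<open>C\<close>, on average
  at most \<open>log 2 (card C)\<close> lead back into \<open>C\<close>. The others give boundary
  edges, all distinct since each has a single endpoint in \<open>C\<close>.\<close>

lemma cube_isoperimetry:
  assumes "C \<subseteq> subcube m K v" "K \<le> m" "C \<noteq> {}"
  shows "(real m - K - log 2 (card C)) * card C \<le> card (bd {e \<in> cubeE m. e \<subseteq> subcube m K v} C)"
proof -
  let ?I = "{K..<m}"
  let ?D = "{(x, i). x \<in> C \<and> i \<in> ?I \<and> flip i x \<in> C}"
  let ?f = "\<lambda>(x, i). {x, flip i x}"
  have CV: "C \<subseteq> cubeV m" using assms(1) by (auto simp: subcube_def)
  then have finC: "finite C" by (rule finite_subset) simp
  have "inj_on ?f (C \<times> ?I - ?D)"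
  proof (rule inj_onI)
    fix a b assume ab: "a \<in> C \<times> ?I - ?D" "b \<in> C \<times> ?I - ?D" "?f a = ?f b"
    obtain x i y j where xy: "a = (x, i)" "b = (y, j)" by (cases a, cases b)
    have *: "x \<in> C" "y \<in> C" "i < m" "j < m" "flip i x \<notin> C" "flip j y \<notin> C"
      "{x, flip i x} = {y, flip j y}" using ab unfolding xy by auto
    then have "x = y" "flip i x = flip j y" by (auto simp: doubleton_eq_iff)
    then show "a = b" using flip_inj_index[of x m i j] * CV unfolding xy by auto
  qed
  moreover have "?f ` (C \<times> ?I - ?D) \<subseteq> bd {e \<in> cubeE m. e \<subseteq> subcube m K v} C"
  proof
    fix e assume "e \<in> ?f ` (C \<times> ?I - ?D)"
    then obtain q where "q \<in> C \<times> ?I - ?D" "e = ?f q" by blast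
    then obtain x i where e: "e = {x, flip i x}" and *: "x \<in> C" "i \<in> ?I" "(x, i) \<notin> ?D"
      by (cases q) auto
    have "x \<in> subcube m K v" "flip i x \<in> subcube m K v"
      using * assms(1) flip_in_cubeV[of x m i] by (auto simp: subcube_def flip_def)
    moreover have "{x, flip i x} \<in> cubeE m" using * CV cubeE_iff by fastforce
    ultimately show "e \<in> bd {e \<in> cubeE m. e \<subseteq> subcube m K v} C"
      using * unfolding bd_def e by blast
  qed
  moreover have "finite (bd {e \<in> cubeE m. e \<subseteq> subcube m K v} C)"
    by (rule finite_subset[of _ "cubeE m"]) (auto simp: bd_def)
  ultimately have "card (C \<times> ?I - ?D) \<le> card (bd {e \<in> cubeE m. e \<subseteq> subcube m K v} C)"
    by (rule card_inj_on_le)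
  moreover have "card (C \<times> ?I) \<le> card (C \<times> ?I - ?D) + card ?D"
  proof -
    have "finite ?D" by (rule finite_subset[of _ "C \<times> ?I"]) (use finC in auto)
    then have "card (C \<times> ?I) \<le> card ((C \<times> ?I - ?D) \<union> ?D)" using finC by (intro card_mono) auto
    also have "\<dots> \<le> card (C \<times> ?I - ?D) + card ?D" by (rule card_Un_le)
    finally show ?thesis .
  qed
  moreover have "real (card ?D) \<le> card C * log 2 (card C)"
    using CV finC by (intro card_internal_flips_le) auto
  moreover have "real (card (C \<times> ?I)) = (real m - K) * card C" using assms(2) by (simp add: card_cartesian_product of_nat_diff)
  ultimately have "(real m - K) * card C \<le> real (card (bd {e \<in> cubeE m. e \<subseteq> subcube m K v} C)) + card C * log 2 (card C)"
    by linarith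
  then show ?thesis by (simp add: algebra_simps)
qed

text \<open>Up to half the cube the logarithm is at most \<open>m - 1\<close>, which leaves one
  boundary edge per vertex.\<close>

lemma cube_half_isoperimetry:
  assumes "C \<subseteq> cubeV m" "2 * card C \<le> 2 ^ m"
  shows "card C \<le> card (bd (cubeE m) C)"
proof (cases "C = {}")
  case False
  have sub: "subcube m 0 v = cubeV m" for v by (simp add: subcube_def)
  then have E: "{e \<in> cubeE m. e \<subseteq> subcube m 0 v} = cubeE m" for v using cubeE_subset by blast
  have fin: "finite C" using assms(1) by (rule finite_subset) simp
  then have pos: "0 < card C" using False by (simp add: card_gt_0_iff)
  have "log 2 (2 * real (card C)) \<le> log 2 (2 ^ m)"
    using assms(2) pos by (subst log_le_cancel_iff)
      (auto simp: of_nat_le_iff[of "2 * card C" "2 ^ m", where 'a = real, simplified])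
  then have "log 2 (card C) \<le> real m - 1" using pos by (simp add: log_mult)
  then have "1 * real (card C) \<le> (real m - 0 - log 2 (card C)) * card C"
    by (intro mult_right_mono) auto
  also have "\<dots> \<le> card (bd (cubeE m) C)"
    using cube_isoperimetry[of C m 0 undefined] assms(1) False unfolding E by (simp add: sub)
  finally show ?thesis by simp
qed simp

section \<open>Vertices far from large clusters\<close>

definition big :: "'a set \<Rightarrow> nat \<Rightarrow> 'a set set \<Rightarrow> 'a set" where
  "big V s F = {v \<in> V. s \<le> card (cluster F V v)}"

text \<open>Only neighbours count: a vertex of \<open>W\<close> itself may be isolated from
  \<open>W\<close>.\<close>

definition isolated :: "'a set \<Rightarrow> 'a set set \<Rightarrow> 'a set \<Rightarrow> 'a set" where
  "isolated V E W = {v \<in> V. \<forall>y. {v, y} \<in> E \<longrightarrow> y \<notin> W}"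

lemma subcube_disjoint:
  assumes "v \<in> cubeV m" "K \<le> m" "i < K" "j < K" "i \<noteq> j"
  shows "subcube m K (flip i v) \<inter> subcube m K (flip j v) = {}"
proof -
  have "x i = flip i v i \<and> x i = flip j v i"
    if "x \<in> subcube m K (flip i v) \<inter> subcube m K (flip j v)" for x
    using that assms(3,4) by (auto simp: subcube_def)
  moreover have "flip j v i = v i" using assms(5) by (simp add: flip_def)
  ultimately show ?thesis using flip_neq[of v m i] assms by fastforce
qed

text \<open>The neighbours \<open>flip i v\<close> with \<open>i < K\<close> lie in pairwise disjoint subcubes of codimension \<open>K\<close>,
  whose percolations are independent.\<close>

lemma prob_isolated_le:
  assumes "v \<in> cubeV m" "K \<le> m" "0 \<le> p" "p \<le> 1" "0 < \<eta>" "0 < s"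
    and "p * (real m - K - log 2 s) \<ge> 1 + \<eta>"
  shows "measure_pmf.prob (percolate (cubeE m) p)
    {F. v \<in> isolated (cubeV m) (cubeE m) (big (cubeV m) s F)} \<le> (1 / (1 + \<eta>)) ^ K"
proof -
  define S where "S = (\<lambda>i. subcube m K (flip i v))"
  define A where "A = (\<lambda>i. {e \<in> cubeE m. e \<subseteq> S i})"
  let ?P = "\<lambda>i F. card (cluster F (S i) (flip i v)) < s"
  have SV: "S i \<subseteq> cubeV m" for i by (auto simp: S_def subcube_def)
  have finS: "finite (S i)" for i using SV by (rule finite_subset) simp
  have fv: "flip i v \<in> S i" if "i < K" for i
    using flip_in_cubeV[OF assms(1)] that assms(2) by (auto simp: S_def subcube_def)
  \<comment> \<open>Restricting to a subcube shrinks clusters, so an isolated \<open>v\<close>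
    forces a small local cluster at every \<open>flip i v\<close>.\<close>
  have "{F. v \<in> isolated (cubeV m) (cubeE m) (big (cubeV m) s F)} \<subseteq> {F. \<forall>i\<in>{..<K}. ?P i (F \<inter> A i)}"
  proof (intro Collect_mono impI ballI)
    fix F i assume iso: "v \<in> isolated (cubeV m) (cubeE m) (big (cubeV m) s F)" and i: "i \<in> {..<K}"
    have "{v, flip i v} \<in> cubeE m" unfolding cubeE_iff
      by (intro exI[of _ v] exI[of _ i]) (use assms(1,2) i in auto)
    then have "flip i v \<notin> big (cubeV m) s F" using iso by (auto simp: isolated_def)
    then have 1: "card (cluster F (cubeV m) (flip i v)) < s"
      using flip_in_cubeV[OF assms(1)] i assms(2) by (auto simp: big_def)
    have "flip i v \<in> cubeV m" using fv SV i by auto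
    then have "finite (cluster F (cubeV m) (flip i v))"
      by (meson cluster_subset finite_cubeV finite_subset)
    then have "card (cluster (F \<inter> A i) (S i) (flip i v)) \<le> card (cluster F (cubeV m) (flip i v))"
      using SV by (intro card_mono cluster_mono) auto
    then show "?P i (F \<inter> A i)" using 1 by simp
  qed
  then have "measure_pmf.prob (percolate (cubeE m) p)
      {F. v \<in> isolated (cubeV m) (cubeE m) (big (cubeV m) s F)} \<le>
      measure_pmf.prob (percolate (cubeE m) p) {F. \<forall>i\<in>{..<K}. ?P i (F \<inter> A i)}"
    by (intro measure_pmf.finite_measure_mono) auto
  also have "\<dots> = (\<Prod>i<K. measure_pmf.prob (percolate (cubeE m) p) {F. ?P i (F \<inter> A i)})"
  proof (intro percolate_indep_family)
    show "disjoint_family_on A {..<K}"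
    proof (unfold disjoint_family_on_def, intro ballI impI)
      fix i j assume "i \<in> {..<K}" "j \<in> {..<K}" "i \<noteq> j"
      then have "S i \<inter> S j = {}" using subcube_disjoint assms by (auto simp: S_def)
      moreover have "e \<noteq> {}" if "e \<in> cubeE m" for e using that cubeE_iff by auto
      ultimately show "A i \<inter> A j = {}" unfolding A_def by blast
    qed
  qed (auto simp: A_def)
  also have "\<dots> \<le> (\<Prod>i<K. 1 / (1 + \<eta>))"
  proof (intro prod_mono conjI)
    fix i assume i: "i \<in> {..<K}"
    have A: "{e \<in> A i. e \<subseteq> S i} = {e \<in> cubeE m. e \<subseteq> S i}" by (auto simp: A_def)
    have "measure_pmf.prob (percolate (cubeE m) p) {F. ?P i (F \<inter> A i)} =
        measure_pmf.prob (percolate (A i) p) {F. ?P i F}"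
      by (rule percolate_restrict) (auto simp: A_def)
    also have "\<dots> \<le> 1 / (1 + \<eta>)"
    proof (rule prob_small_cluster_le)
      show "finite (A i)" by (auto simp: A_def)
      show "flip i v \<in> S i" using fv i by auto
      fix C assume C: "flip i v \<in> C" "C \<subseteq> S i" "card C < s"
      then have "0 < card C" using finS by (metis card_gt_0_iff empty_iff finite_subset)
      then have "log 2 (card C) \<le> log 2 s" using C(3) assms(6) by (subst log_le_cancel_iff) auto
      then have "(real m - K - log 2 s) * card C \<le> (real m - K - log 2 (card C)) * card C"
        by (intro mult_right_mono) auto
      also have "\<dots> \<le> card (bd {e \<in> A i. e \<subseteq> S i} C)"
        unfolding A using C assms(2) unfolding S_def by (intro cube_isoperimetry) auto
      finally show "(real m - K - log 2 s) * card C \<le> card (bd {e \<in> A i. e \<subseteq> S i} C)" .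
    qed (use assms finS in auto)
    finally show "measure_pmf.prob (percolate (cubeE m) p) {F. ?P i (F \<inter> A i)} \<le> 1 / (1 + \<eta>)" .
  qed auto
  finally show ?thesis by simp
qed

text \<open>Markov's inequality for \<open>card (B F)\<close>, whose expectation is the sum of the
  point probabilities.\<close>

lemma prob_card_ge_le:
  fixes \<rho> a :: real
  assumes "finite V" "0 < a" "\<And>F. B F \<subseteq> V" "\<And>v. v \<in> V \<Longrightarrow> measure_pmf.prob M {F. v \<in> B F} \<le> \<rho>"
  shows "measure_pmf.prob M {F. a \<le> real (card (B F))} \<le> card V * \<rho> / a"
proof -
  have "a * measure_pmf.prob M {F. a \<le> real (card (B F))} =
      (\<integral>F. a * indicator {F. a \<le> real (card (B F))} F \<partial>measure_pmf M)" by simp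
  also have "\<dots> \<le> (\<integral>F. (\<Sum>v\<in>V. indicator {F. v \<in> B F} F) \<partial>measure_pmf M)"
  proof (intro integral_mono)
    fix F
    have "(\<Sum>v\<in>V. indicator {F. v \<in> B F} F) = (\<Sum>v\<in>V. if v \<in> B F then 1 else (0::real))"
      by (intro sum.cong) (auto simp: indicator_def)
    also have "\<dots> = card (V \<inter> B F)" using assms(1) by (simp add: sum.If_cases)
    also have "V \<inter> B F = B F" using assms(3) by auto
    finally show "a * indicator {F. a \<le> real (card (B F))} F \<le> (\<Sum>v\<in>V. indicator {F. v \<in> B F} F)"
      by (auto simp: indicator_def)
  qed (auto simp: less_top[symmetric])
  also have "\<dots> = (\<Sum>v\<in>V. measure_pmf.prob M {F. v \<in> B F})"
    by (subst Bochner_Integration.integral_sum) (auto simp: less_top[symmetric])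
  also have "\<dots> \<le> card V * \<rho>" 
    using sum_bounded_above[of V "\<lambda>v. measure_pmf.prob M {F. v \<in> B F}" \<rho>] assms(4) by simp
  finally show ?thesis using assms(2) by (simp add: field_simps)
qed

section \<open>Sprinkling in an expanding graph\<close>

text \<open>A closed set is a union of clusters inside \<open>S\<close>, hence determined by the
  clusters that it contains.\<close>

lemma card_closed_sets_le:
  assumes "finite S"
  shows "card {A. A \<subseteq> S \<and> (\<forall>x\<in>A. \<forall>y\<in>S. {x, y} \<in> F \<longrightarrow> y \<in> A)} \<le> 2 ^ card (cluster F S ` S)"
proof -
  have "{A. A \<subseteq> S \<and> (\<forall>x\<in>A. \<forall>y\<in>S. {x, y} \<in> F \<longrightarrow> y \<in> A)} \<subseteq> Union ` Pow (cluster F S ` S)"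
  proof
    fix A assume "A \<in> {A. A \<subseteq> S \<and> (\<forall>x\<in>A. \<forall>y\<in>S. {x, y} \<in> F \<longrightarrow> y \<in> A)}"
    then have A: "A \<subseteq> S" "\<forall>x\<in>A. \<forall>y\<in>S. {x, y} \<in> F \<longrightarrow> y \<in> A" by auto
    have "cluster F S x \<subseteq> A" if "x \<in> A" for x using that A by (intro cluster_closed) auto
    then have "A = \<Union> (cluster F S ` A)" by auto
    then show "A \<in> Union ` Pow (cluster F S ` S)" using A(1) by blast
  qed
  then have "card {A. A \<subseteq> S \<and> (\<forall>x\<in>A. \<forall>y\<in>S. {x, y} \<in> F \<longrightarrow> y \<in> A)} \<le> card (Union ` Pow (cluster F S ` S))"
    using assms by (intro card_mono) auto
  also have "\<dots> \<le> card (Pow (cluster F S ` S))" using assms by (intro card_image_le) auto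
  also have "\<dots> = 2 ^ card (cluster F S ` S)" using assms by (intro card_Pow) auto
  finally show ?thesis .
qed

lemma card_small_subsets_le:
  assumes "finite V"
  shows "card {X. X \<subseteq> V \<and> card X \<le> L} \<le> (card V + 1) ^ L"
proof (induction L)
  case 0
  have "{X. X \<subseteq> V \<and> card X \<le> 0} \<subseteq> {{}}" using assms finite_subset by fastforce
  then show ?case by (metis card_mono card_1_singleton_iff finite.emptyI finite.insertI power_0 is_singletonI One_nat_def
      is_singleton_altdef)
next
  case (Suc L)
  let ?S = "{X. X \<subseteq> V \<and> card X \<le> L}"
  have finS: "finite ?S" using assms by (auto intro: finite_subset[of _ "Pow V"])
  have "{X. X \<subseteq> V \<and> card X \<le> Suc L} \<subseteq> ?S \<union> (\<lambda>(x, X). insert x X) ` (V \<times> ?S)"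
  proof
    fix X assume X: "X \<in> {X. X \<subseteq> V \<and> card X \<le> Suc L}"
    then have finX: "finite X" using assms finite_subset by auto
    show "X \<in> ?S \<union> (\<lambda>(x, X). insert x X) ` (V \<times> ?S)"
    proof (cases "X = {}")
      case False
      then obtain x where x: "x \<in> X" by auto
      then have "X = insert x (X - {x})" "card (X - {x}) \<le> L" using X finX by auto
      then show ?thesis using X x by (intro UnI2 image_eqI[of _ _ "(x, X - {x})"]) auto
    qed simp
  qed
  then have "card {X. X \<subseteq> V \<and> card X \<le> Suc L} \<le> card (?S \<union> (\<lambda>(x, X). insert x X) ` (V \<times> ?S))"
    using finS assms by (intro card_mono) auto
  also have "\<dots> \<le> card ?S + card ((\<lambda>(x, X). insert x X) ` (V \<times> ?S))" by (rule card_Un_le)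
  also have "card ((\<lambda>(x, X). insert x X) ` (V \<times> ?S)) \<le> card (V \<times> ?S)"
    using finS assms by (intro card_image_le) auto
  also have "card ?S + card (V \<times> ?S) = (card V + 1) * card ?S" by (simp add: card_cartesian_product)
  also have "\<dots> \<le> (card V + 1) * (card V + 1) ^ L" using Suc by (intro mult_left_mono) auto
  finally show ?case by simp
qed

section \<open>Short links across a separation\<close>

fun link_verts :: "'a \<times> 'a \<times> 'a \<times> 'a \<Rightarrow> 'a set" where
  "link_verts (a, x, y, b) = {a, x, y, b}"

text \<open>Shorter paths are encoded by repeating vertices, which creates singletons here; openness
  of a link is therefore stated for \<open>link_edges q \<inter> E\<close>.\<close>

fun link_edges :: "'a \<times> 'a \<times> 'a \<times> 'a \<Rightarrow> 'a set set" where
  "link_edges (a, x, y, b) = {{a, x}, {x, y}, {y, b}}"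

text \<open>What the second round needs of the cube: bounded degree, and edge expansion of all sets
  up to half the vertices.\<close>

locale expanding_graph =
  fixes V :: "'a set" and E :: "'a set set" and m :: nat
  assumes finite_V: "finite V"
    and edge_doubleton: "e \<in> E \<Longrightarrow> \<exists>x y. e = {x, y}"
    and edge_in_V: "{x, y} \<in> E \<Longrightarrow> x \<in> V \<and> y \<in> V"
    and degree_le: "card {y. {x, y} \<in> E} \<le> m"
    and half_isoperimetry: "\<lbrakk>C \<subseteq> V; 2 * card C \<le> card V\<rbrakk> \<Longrightarrow> card C \<le> card (bd E C)"
begin

fun link :: "'a set \<Rightarrow> 'a set \<Rightarrow> 'a set \<Rightarrow> 'a \<times> 'a \<times> 'a \<times> 'a \<Rightarrow> bool" where
  "link A B X (a, x, y, b) \<longleftrightarrow> a \<in> A \<and> b \<in> B \<and> {a, x, y, b} \<subseteq> V - X \<and>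
    (a = x \<or> {a, x} \<in> E) \<and> (x = y \<or> {x, y} \<in> E) \<and> (y = b \<or> {y, b} \<in> E)"

lemma finite_E: "finite E"
proof -
  have "e \<subseteq> V" if "e \<in> E" for e
    using edge_doubleton[OF that] edge_in_V that by blast
  then show ?thesis using finite_V by (meson Pow_iff finite_Pow_iff finite_subset subsetI)
qed

lemma finite_nbrs: "finite {y. {x, y} \<in> E}"
  by (rule finite_subset[OF _ finite_V]) (auto dest: edge_in_V)

lemma card_UN_nbrs_le:
  assumes "finite X"
  shows "card (\<Union>x\<in>X. {y. {x, y} \<in> E}) \<le> m * card X"
proof -
  have "card (\<Union>x\<in>X. {y. {x, y} \<in> E}) \<le> (\<Sum>x\<in>X. card {y. {x, y} \<in> E})"
    by (rule card_UN_le[OF assms])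
  also have "\<dots> \<le> (\<Sum>x\<in>X. m)" by (intro sum_mono degree_le)
  finally show ?thesis by (simp add: mult.commute)
qed

lemma card_UN_incident_le:
  assumes "finite Z"
  shows "card (\<Union>z\<in>Z. {e \<in> E. z \<in> e}) \<le> m * card Z"
proof -
  have "card {e \<in> E. z \<in> e} \<le> m" for z
  proof -
    have "{e \<in> E. z \<in> e} \<subseteq> (\<lambda>y. {z, y}) ` {y. {z, y} \<in> E}"
    proof
      fix e assume e: "e \<in> {e \<in> E. z \<in> e}"
      then obtain x y where "e = {x, y}" using edge_doubleton by blast
      with e show "e \<in> (\<lambda>y. {z, y}) ` {y. {z, y} \<in> E}" by (auto simp: insert_commute)
    qed
    then have "card {e \<in> E. z \<in> e} \<le> card ((\<lambda>y. {z, y}) ` {y. {z, y} \<in> E})"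
      using finite_nbrs by (intro card_mono) auto
    also have "\<dots> \<le> card {y. {z, y} \<in> E}" using finite_nbrs by (rule card_image_le)
    finally show ?thesis using degree_le[of z] by linarith
  qed
  then have "(\<Sum>z\<in>Z. card {e \<in> E. z \<in> e}) \<le> (\<Sum>z\<in>Z. m)" by (intro sum_mono)
  moreover have "card (\<Union>z\<in>Z. {e \<in> E. z \<in> e}) \<le> (\<Sum>z\<in>Z. card {e \<in> E. z \<in> e})"
    by (rule card_UN_le[OF assms])
  ultimately show ?thesis by (simp add: mult.commute)
qed

text \<open>Without a link, the neighbourhoods \<open>N A\<close> and \<open>N B\<close> outside
  \<open>X\<close> are disjoint and have no edge between them. All boundary edges of the smaller one
  then end in the leftover \<open>Z\<close>, whose vertices lie in \<open>X\<close>, are adjacent to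
  \<open>X\<close> or are isolated. So \<open>Z\<close> is small, and isoperimetry makes that
  neighbourhood too small.\<close>

lemma link_exists:
  assumes "A \<subseteq> V" "B \<subseteq> V" "X \<subseteq> V"
    and "(m * m + m + 1) * card X + m * card (isolated V E (A \<union> B \<union> X)) < card A"
    and "(m * m + m + 1) * card X + m * card (isolated V E (A \<union> B \<union> X)) < card B"
  shows "\<exists>q. link A B X q"
proof (rule ccontr)
  assume no: "\<nexists>q. link A B X q"
  define N where "N = (\<lambda>S. {x \<in> V - X. \<exists>a\<in>S - X. a = x \<or> {a, x} \<in> E})"
  have sep: "\<not> (x = y \<or> {x, y} \<in> E)" if "x \<in> N A" "y \<in> N B" for x y
  proof
    assume xy: "x = y \<or> {x, y} \<in> E"
    obtain a b where "a \<in> A - X" "a = x \<or> {a, x} \<in> E" "b \<in> B - X" "y = b \<or> {y, b} \<in> E"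
      using \<open>x \<in> N A\<close> \<open>y \<in> N B\<close> by (auto simp: N_def insert_commute)
    then have "link A B X (a, x, y, b)" using xy that assms(1,2) by (auto simp: N_def)
    then show False using no by blast
  qed
  define Z where "Z = V - N A - N B"
  let ?I = "isolated V E (A \<union> B \<union> X)"
  have fin: "finite X" "finite ?I" "finite Z"
    using finite_V assms(3) by (auto simp: isolated_def Z_def finite_subset)
  have finU: "finite (\<Union>x\<in>X. {y. {x, y} \<in> E})" using fin finite_nbrs by auto
  have "Z \<subseteq> X \<union> (\<Union>x\<in>X. {y. {x, y} \<in> E}) \<union> ?I"
  proof
    fix z assume z: "z \<in> Z"
    show "z \<in> X \<union> (\<Union>x\<in>X. {y. {x, y} \<in> E}) \<union> ?I"
    proof (rule ccontr)
      assume "z \<notin> X \<union> (\<Union>x\<in>X. {y. {x, y} \<in> E}) \<union> ?I"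
      then have z': "z \<in> V - X" "z \<notin> N A" "z \<notin> N B" "\<forall>x\<in>X. {x, z} \<notin> E" "z \<notin> ?I"
        using z by (auto simp: Z_def)
      then obtain y where "{z, y} \<in> E" "y \<in> A \<union> B \<union> X" by (auto simp: isolated_def)
      then have "{y, z} \<in> E" "y \<in> A - X \<or> y \<in> B - X" using z' by (auto simp: insert_commute)
      then show False using z' by (auto simp: N_def)
    qed
  qed
  then have "card Z \<le> card (X \<union> (\<Union>x\<in>X. {y. {x, y} \<in> E}) \<union> ?I)"
    using fin finU by (intro card_mono) auto
  also have "\<dots> \<le> card X + card (\<Union>x\<in>X. {y. {x, y} \<in> E}) + card ?I"
    by (meson card_Un_le add_right_mono le_trans)
  also have "\<dots> \<le> card X + m * card X + card ?I" using card_UN_nbrs_le[OF fin(1)] by simp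
  finally have cardZ: "card Z \<le> card X + m * card X + card ?I" .
  have bound: "card C \<le> m * card Z" if C: "C = N A \<and> D = N B \<or> C = N B \<and> D = N A"
      "2 * card C \<le> card V" for C D
  proof -
    have CV: "C \<subseteq> V" using C by (auto simp: N_def)
    have "bd E C \<subseteq> (\<Union>z\<in>Z. {e \<in> E. z \<in> e})"
    proof
      fix e assume "e \<in> bd E C"
      then obtain x y where e: "e \<in> E" "e = {x, y}" "x \<in> C" "y \<notin> C" by (auto simp: bd_def)
      have "y \<in> V" using e edge_in_V by blast
      moreover have "y \<notin> D" using sep[of x y] sep[of y x] e C(1) by (auto simp: insert_commute)
      ultimately have "y \<in> Z" using C(1) e by (auto simp: Z_def)
      then show "e \<in> (\<Union>z\<in>Z. {e \<in> E. z \<in> e})" using e by auto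
    qed
    moreover have "finite (\<Union>z\<in>Z. {e \<in> E. z \<in> e})" using fin finite_E by auto
    ultimately have "card (bd E C) \<le> card (\<Union>z\<in>Z. {e \<in> E. z \<in> e})" by (intro card_mono)
    also have "\<dots> \<le> m * card Z" using fin by (intro card_UN_incident_le)
    finally show ?thesis using half_isoperimetry[OF CV C(2)] by linarith
  qed
  have finN: "finite (N S)" for S using finite_V by (auto simp: N_def)
  have NS: "card S \<le> card X + card (N S)" if S: "S \<subseteq> V" for S
  proof -
    have "card S \<le> card (X \<union> N S)" using S fin finN by (intro card_mono) (auto simp: N_def)
    then show ?thesis using card_Un_le[of X "N S"] by linarith
  qed
  have "N A \<inter> N B = {}" using sep by auto
  then have "card (N A) + card (N B) = card (N A \<union> N B)" using finN by (simp add: card_Un_disjoint)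
  also have "\<dots> \<le> card V" using finite_V by (intro card_mono) (auto simp: N_def)
  finally have "2 * card (N A) \<le> card V \<or> 2 * card (N B) \<le> card V" by linarith
  then have "card (N A) \<le> m * card Z \<or> card (N B) \<le> m * card Z" using bound by blast
  moreover have "m * card Z \<le> m * (card X + m * card X + card ?I)" using cardZ by simp
  \<comment> \<open>The extra \<open>card X\<close> is the loss in passing from \<open>A\<close> to
    \<open>N A\<close>, as \<open>A\<close> is covered by \<open>X\<close> and \<open>N A\<close>;
    likewise for \<open>B\<close>.\<close>
  moreover have "m * (card X + m * card X + card ?I) + card X =
      (m * m + m + 1) * card X + m * card ?I" by (simp add: algebra_simps)
  ultimately show False using NS[OF assms(1)] NS[OF assms(2)] assms(4,5) by linarith
qed

lemma isolated_antimono: "W \<subseteq> W' \<Longrightarrow> isolated V E W' \<subseteq> isolated V E W"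
  by (auto simp: isolated_def)

text \<open>Greedy choice: the at most \<open>4 * t\<close> vertices of the links found so far join
  the forbidden set \<open>X\<close>. This enlarges \<open>A \<union> B \<union> X\<close> and so
  creates no new isolated vertices.\<close>

lemma disjoint_links_exist:
  assumes "A \<subseteq> V" "B \<subseteq> V" "X \<subseteq> V"
    and "(m * m + m + 1) * (card X + 4 * t) + m * card (isolated V E (A \<union> B \<union> X)) < card A"
    and "(m * m + m + 1) * (card X + 4 * t) + m * card (isolated V E (A \<union> B \<union> X)) < card B"
  shows "\<exists>Q. finite Q \<and> t \<le> card Q \<and> (\<forall>q\<in>Q. link A B X q) \<and> disjoint_family_on link_verts Q"
proof -
  define ok where "ok = (\<lambda>Q. finite Q \<and> (\<forall>q\<in>Q. link A B X q) \<and> disjoint_family_on link_verts Q)"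
  have "\<exists>Q. ok Q \<and> card Q = n" if "n \<le> t" for n
    using that
  proof (induction n)
    case 0
    then show ?case by (intro exI[of _ "{}"]) (auto simp: ok_def disjoint_family_on_def)
  next
    case (Suc n)
    then obtain Q where Q: "ok Q" "card Q = n" by auto
    define Y where "Y = (\<Union>q\<in>Q. link_verts q)"
    have finQ: "finite Q" using Q by (simp add: ok_def)
    have YV: "Y \<subseteq> V - X"
    proof
      fix y assume "y \<in> Y"
      then obtain q where "q \<in> Q" "y \<in> link_verts q" by (auto simp: Y_def)
      then show "y \<in> V - X" using Q by (cases q) (auto simp: ok_def)
    qed
    have "card (link_verts q) \<le> 4" for q :: "'a \<times> 'a \<times> 'a \<times> 'a"
      by (cases q) (auto simp: card_insert_if)
    then have "(\<Sum>q\<in>Q. card (link_verts q)) \<le> (\<Sum>q\<in>Q. 4)" by (intro sum_mono)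
    moreover have "card Y \<le> (\<Sum>q\<in>Q. card (link_verts q))" unfolding Y_def by (rule card_UN_le[OF finQ])
    ultimately have "card Y \<le> 4 * t" using Q(2) Suc.prems by simp
    then have cardXY: "card (X \<union> Y) \<le> card X + 4 * t" using card_Un_le[of X Y] by linarith
    have "card (isolated V E (A \<union> B \<union> (X \<union> Y))) \<le> card (isolated V E (A \<union> B \<union> X))"
      using finite_V by (intro card_mono isolated_antimono) (auto simp: isolated_def)
    then have "(m * m + m + 1) * card (X \<union> Y) + m * card (isolated V E (A \<union> B \<union> (X \<union> Y))) \<le>
        (m * m + m + 1) * (card X + 4 * t) + m * card (isolated V E (A \<union> B \<union> X))"
      using cardXY by (intro add_mono mult_left_mono) auto
    then have "\<exists>q. link A B (X \<union> Y) q"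
      using assms YV by (intro link_exists) auto
    then obtain q where q: "link A B (X \<union> Y) q" by blast
    have qX: "link A B X q" and qY: "link_verts q \<inter> Y = {}" and ne: "link_verts q \<noteq> {}"
      using q by (cases q; auto)+
    have "q \<notin> Q" using qY ne by (auto simp: Y_def)
    moreover have "ok (insert q Q)"
      using Q(1) qX qY by (auto simp: ok_def Y_def disjoint_family_on_def)
    ultimately show ?case using Q finQ by (intro exI[of _ "insert q Q"]) auto
  qed
  then show ?thesis using ok_def by blast
qed

text \<open>Disjoint vertex sets give disjoint edge sets, so the links are open independently, each
  with probability at least \<open>p ^ 3\<close> because it has at most three edges.\<close>

lemma prob_all_links_closed_le:
  assumes "finite Q" "\<And>q. q \<in> Q \<Longrightarrow> link A B X q" "disjoint_family_on link_verts Q" "t \<le> card Q"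
    and "0 \<le> p" "p \<le> 1"
  shows "measure_pmf.prob (percolate E p) {F. \<forall>q\<in>Q. \<not> link_edges q \<inter> E \<subseteq> F} \<le> (1 - p ^ 3) ^ t"
proof -
  define A where "A = (\<lambda>q. link_edges q \<inter> E)"
  have disj: "disjoint_family_on A Q"
  proof (unfold disjoint_family_on_def, intro ballI impI)
    fix q r assume "q \<in> Q" "r \<in> Q" "q \<noteq> r"
    then have "link_verts q \<inter> link_verts r = {}" using assms(3) by (auto simp: disjoint_family_on_def)
    moreover have "e \<subseteq> link_verts q" "e \<noteq> {}" if "e \<in> link_edges q" for e and q :: "'a \<times> 'a \<times> 'a \<times> 'a"
      using that by (cases q; auto)+
    ultimately show "A q \<inter> A r = {}" unfolding A_def by (metis (no_types, lifting) Int_iff disjoint_iff equals0I subset_empty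
          Int_greatest)
  qed
  have p3: "0 \<le> p ^ 3" "p ^ 3 \<le> 1" using assms(5,6) by (auto simp: power_le_one)
  have "{F. \<forall>q\<in>Q. \<not> link_edges q \<inter> E \<subseteq> F} = {F. \<forall>q\<in>Q. \<not> A q \<subseteq> F \<inter> A q}" by (auto simp: A_def)
  then have "measure_pmf.prob (percolate E p) {F. \<forall>q\<in>Q. \<not> link_edges q \<inter> E \<subseteq> F} =
      measure_pmf.prob (percolate E p) {F. \<forall>q\<in>Q. \<not> A q \<subseteq> F \<inter> A q}" by simp
  also have "\<dots> = (\<Prod>q\<in>Q. measure_pmf.prob (percolate E p) {F. \<not> A q \<subseteq> F \<inter> A q})"
    using assms(1) finite_E disj by (rule percolate_indep_family) (auto simp: A_def)
  also have "\<dots> \<le> (\<Prod>q\<in>Q. 1 - p ^ 3)"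
  proof (intro prod_mono conjI)
    fix q assume "q \<in> Q"
    have "card (A q) \<le> card (link_edges q)" unfolding A_def by (cases q) (auto intro!: card_mono)
    also have "\<dots> \<le> 3" by (cases q) (auto simp: card_insert_if)
    finally have "p ^ 3 \<le> p ^ card (A q)" using assms(5,6) by (intro power_decreasing) auto
    also have "\<dots> = measure_pmf.prob (percolate E p) {F. A q \<subseteq> F}"
      using finite_E assms(5,6) by (intro percolate_prob_superset[symmetric]) (auto simp: A_def)
    also have "\<dots> = 1 - measure_pmf.prob (percolate E p) (UNIV - {F. A q \<subseteq> F})"
      using measure_pmf.prob_compl[of "{F. A q \<subseteq> F}" "percolate E p"] by simp
    also have "UNIV - {F. A q \<subseteq> F} = {F. \<not> A q \<subseteq> F \<inter> A q}" by auto
    finally show "measure_pmf.prob (percolate E p) {F. \<not> A q \<subseteq> F \<inter> A q} \<le> 1 - p ^ 3" by simp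
  qed auto
  also have "\<dots> = (1 - p ^ 3) ^ card Q" by simp
  also have "\<dots> \<le> (1 - p ^ 3) ^ t" using p3 assms(4) by (intro power_decreasing) auto
  finally show ?thesis .
qed

text \<open>A remaining cluster that contains no neighbour of \<open>X\<close> is a full cluster of
  \<open>F\<close>, so it has at least \<open>s\<close> vertices and there are at most
  \<open>card V / s\<close> of this kind. Every other one contains one of the at most
  \<open>m * card X\<close> neighbours of \<open>X\<close>.\<close>

lemma card_big_clusters_le:
  assumes "F \<subseteq> E" "X \<subseteq> V" "0 < s"
  shows "card (cluster F (big V s F - X) ` (big V s F - X)) \<le> card V / s + m * card X"
proof -
  define S where "S = big V s F - X"
  define NX where "NX = (\<Union>x\<in>X. {y. {x, y} \<in> E})"
  define R where "R = {K \<in> cluster F S ` S. K \<inter> NX = {}}"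
  have SV: "S \<subseteq> V" by (auto simp: S_def big_def)
  have fin: "finite S" "finite X" using SV assms(2) finite_V finite_subset by blast+
  have finNX: "finite NX" unfolding NX_def using fin finite_nbrs by auto
  have "cluster F S ` S \<subseteq> R \<union> cluster F S ` (NX \<inter> S)"
  proof
    fix K assume K: "K \<in> cluster F S ` S"
    then obtain x where x: "x \<in> S" "K = cluster F S x" by auto
    show "K \<in> R \<union> cluster F S ` (NX \<inter> S)"
    proof (cases "K \<inter> NX = {}")
      case False
      then obtain y where "y \<in> K" "y \<in> NX" by auto
      then have "y \<in> NX \<inter> S" "K = cluster F S y" using x cluster_subset[OF x(1)] cluster_eq[of y F S x] by auto
      then show ?thesis by auto
    qed (use K in \<open>auto simp: R_def\<close>)
  qed
  moreover have "finite R" using fin by (auto simp: R_def)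
  ultimately have "card (cluster F S ` S) \<le> card (R \<union> cluster F S ` (NX \<inter> S))"
    using fin by (intro card_mono) auto
  also have "\<dots> \<le> card R + card (cluster F S ` (NX \<inter> S))" by (rule card_Un_le)
  also have "card (cluster F S ` (NX \<inter> S)) \<le> card (NX \<inter> S)" using fin by (intro card_image_le) auto
  also have "card (NX \<inter> S) \<le> card NX" using finNX by (intro card_mono) auto
  also have "card NX \<le> m * card X" unfolding NX_def using fin(2) by (rule card_UN_nbrs_le)
  finally have 1: "card (cluster F S ` S) \<le> card R + m * card X" by simp
  have Rs: "s \<le> card K \<and> K \<subseteq> V" if K: "K \<in> R" for K
  proof -
    obtain x where x: "x \<in> S" "K = cluster F S x" "K \<inter> NX = {}" using K unfolding R_def by blast
    have KS: "K \<subseteq> S" using cluster_subset[OF x(1)] x(2) by simp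
    have "cluster F V x \<subseteq> K"
    proof (rule cluster_closed)
      fix y z assume *: "y \<in> K" "y \<in> V" "z \<in> V" "{y, z} \<in> F"
      have ybig: "y \<in> big V s F" using * KS by (auto simp: S_def)
      have "z \<in> cluster F V y" by (rule cluster_step[OF cluster_refl *(2-4)])
      then have "cluster F V z = cluster F V y" by (rule cluster_eq)
      then have "z \<in> big V s F" using ybig *(3) by (simp add: big_def)
      moreover have "z \<notin> X"
      proof
        assume "z \<in> X"
        moreover have "{z, y} \<in> E" using *(4) assms(1) by (auto simp: insert_commute)
        ultimately have "y \<in> NX" by (auto simp: NX_def)
        then show False using *(1) x(3) by auto
      qed
      ultimately have "z \<in> S" by (simp add: S_def)
      moreover have "y \<in> S" using *(1) KS by blast
      ultimately show "z \<in> K" using cluster_step[of y F S x z] *(1,4) unfolding x(2) by blast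
    qed (simp add: x(2))
    moreover have "finite K" using KS fin finite_subset by blast
    ultimately have "card (cluster F V x) \<le> card K" by (intro card_mono)
    then show ?thesis using x(1) KS SV by (auto simp: S_def big_def)
  qed
  have "card R * s = (\<Sum>K\<in>R. s)" by simp
  also have "\<dots> \<le> (\<Sum>K\<in>R. card K)" using Rs by (intro sum_mono) auto
  also have "\<dots> = card (\<Union>R)"
  proof (rule card_Union_disjoint[symmetric])
    show "disjoint R"
    proof (rule disjointI)
      fix K K' assume "K \<in> R" "K' \<in> R" "K \<noteq> K'"
      then obtain x x' where "K = cluster F S x" "K' = cluster F S x'" unfolding R_def by blast
      then show "K \<inter> K' = {}" using cluster_eq[of _ F S x] cluster_eq[of _ F S x'] \<open>K \<noteq> K'\<close> by blast
    qed
    show "finite K" if "K \<in> R" for K using Rs[OF that] finite_V finite_subset by blast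
  qed
  also have "\<dots> \<le> card V" using Rs finite_V by (intro card_mono) auto
  finally have "real (card R) * s \<le> card V" by (metis of_nat_le_iff of_nat_mult)
  then have "card R \<le> card V / s" using assms(3) by (simp add: pos_le_divide_eq)
  then show ?thesis using 1 unfolding S_def[symmetric] by linarith
qed

lemma link_crosses:
  assumes "link A B X q" "link_edges q \<inter> E \<subseteq> F" "A \<subseteq> C" "B \<subseteq> V - X - C" "\<forall>x\<in>C. \<forall>y\<in>V - X - C. {x, y} \<notin> F"
  shows False
proof (cases q)
  case (fields a x y b)
  have step: "v \<in> C" if "u \<in> C" "u = v \<or> {u, v} \<in> E \<and> {u, v} \<in> F" "v \<in> V - X" for u v
    using that assms(5) by blast
  have "a \<in> C" using assms(1,3) fields by auto
  then have "x \<in> C" using assms(1,2) fields by (intro step[of a x]) auto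
  then have "y \<in> C" using assms(1,2) fields by (intro step[of x y]) auto
  then have "b \<in> C" using assms(1,2) fields by (intro step[of y b]) auto
  then show False using assms(1,4) fields by auto
qed

text \<open>The first round \<open>F1\<close> is fixed and only the second is random. The three
  factors bound the number of separators, the number of traces for each, and the probability that a
  prescribed family of links stays closed.\<close>

lemma prob_no_long_cycle_le:
  fixes F1 :: "'a set set" and s L n t :: nat
  defines "W \<equiv> big V s F1"
  assumes "F1 \<subseteq> E" "3 \<le> L" "0 < s" "0 \<le> p" "p \<le> 1"
    and n: "card V / s + m * L \<le> n"
    and W: "4 * ((m * m + m + 1) * (L + 4 * t) + m * card (isolated V E W)) + 4 * L < card W"
  shows "measure_pmf.prob (percolate E p) {F2. \<forall>c. is_cycle (V, F1 \<union> F2) c \<longrightarrow> length c < L} \<le>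
    (real (card V) + 1) ^ L * 2 ^ n * (1 - p ^ 3) ^ t"
proof -
  define k where "k = (m * m + m + 1) * (L + 4 * t) + m * card (isolated V E W)"
  define CL where "CL = (\<lambda>X. {A. A \<subseteq> W - X \<and> (\<forall>x\<in>A. \<forall>y\<in>W - X. {x, y} \<in> F1 \<longrightarrow> y \<in> A)})"
  \<comment> \<open>A candidate consists of a separator and the trace of one side on
    \<open>W\<close>. Since \<open>CL\<close> refers to \<open>F1\<close> alone, \<open>I\<close>
    does not depend on the second round.\<close>
  define I where "I = {(X, A). X \<subseteq> V \<and> card X \<le> L \<and> A \<in> CL X \<and> k < card A \<and> k < card (W - X - A)}"
  have WV: "W \<subseteq> V" by (auto simp: W_def big_def)
  have finW: "finite W" using WV finite_V finite_subset by blast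
  have "\<exists>Q. finite Q \<and> t \<le> card Q \<and> (\<forall>q\<in>Q. link A (W - X - A) X q) \<and> disjoint_family_on link_verts Q"
    if XA: "(X, A) \<in> I" for X A
  proof -
    have A: "A \<subseteq> W - X" "X \<subseteq> V" "card X \<le> L" "k < card A" "k < card (W - X - A)"
      using XA by (auto simp: I_def CL_def)
    have "isolated V E (A \<union> (W - X - A) \<union> X) \<subseteq> isolated V E W"
      by (rule isolated_antimono) auto
    then have "card (isolated V E (A \<union> (W - X - A) \<union> X)) \<le> card (isolated V E W)"
      using finite_V by (intro card_mono) (auto simp: isolated_def)
    then have "(m * m + m + 1) * (card X + 4 * t) + m * card (isolated V E (A \<union> (W - X - A) \<union> X)) \<le> k"
      using A(3) unfolding k_def by (intro add_mono mult_left_mono) auto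
    then show ?thesis using A WV by (intro disjoint_links_exist) auto
  qed
  \<comment> \<open>The links are chosen from \<open>(X, A)\<close> before the second round is
    drawn, so each choice is a fixed family.\<close>
  then obtain Q where Q: "\<And>X A. (X, A) \<in> I \<Longrightarrow> finite (Q X A) \<and> t \<le> card (Q X A) \<and>
      (\<forall>q\<in>Q X A. link A (W - X - A) X q) \<and> disjoint_family_on link_verts (Q X A)"
    by metis
  define Bad where "Bad = (\<lambda>(X, A). {F2. \<forall>q\<in>Q X A. \<not> link_edges q \<inter> E \<subseteq> F2})"
  have cover: "F2 \<in> (\<Union>i\<in>I. Bad i)"
    if F2: "F2 \<in> set_pmf (percolate E p)" "\<forall>c. is_cycle (V, F1 \<union> F2) c \<longrightarrow> length c < L" for F2
  proof -
    have F2E: "F2 \<subseteq> E" using F2(1) by (rule percolate_subset)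
    have "\<exists>X A. X \<subseteq> V \<and> A \<subseteq> V - X \<and> card X \<le> L \<and> (\<forall>x\<in>A. \<forall>y\<in>V - X - A. {x, y} \<notin> F1 \<union> F2) \<and>
        card W \<le> 4 * card (A \<inter> W) + 4 * L \<and> card W \<le> 4 * card ((V - X - A) \<inter> W) + 4 * L"
    proof (rule balanced_separation_exists)
      show "x \<in> V \<and> y \<in> V" if "{x, y} \<in> F1 \<union> F2" for x y using that edge_in_V F2E assms(2) by blast
    qed (use finite_V assms(3) WV F2(2) in auto)
    then obtain X A where XA: "X \<subseteq> V" "A \<subseteq> V - X" "card X \<le> L"
      "\<forall>x\<in>A. \<forall>y\<in>V - X - A. {x, y} \<notin> F1 \<union> F2" "card W \<le> 4 * card (A \<inter> W) + 4 * L"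
      "card W \<le> 4 * card ((V - X - A) \<inter> W) + 4 * L" by blast
    have eq: "W - X - A \<inter> W = (V - X - A) \<inter> W" using WV by auto
    \<comment> \<open>Each side keeps a quarter of \<open>W\<close> up to an error \<open>L\<close>,
      which explains the form \<open>4 * k + 4 * L\<close> of the hypothesis on
      \<open>card W\<close>.\<close>
    have "k < card (A \<inter> W)" "k < card (W - X - A \<inter> W)"
      using W XA(5,6) unfolding eq k_def[symmetric] by linarith+
    moreover have "A \<inter> W \<in> CL X" unfolding CL_def using XA(2,4) WV by blast
    ultimately have I: "(X, A \<inter> W) \<in> I" using XA by (simp add: I_def)
    have "F2 \<in> Bad (X, A \<inter> W)"
    proof (unfold Bad_def prod.case, intro CollectI ballI notI)
      fix q assume q: "q \<in> Q X (A \<inter> W)" "link_edges q \<inter> E \<subseteq> F2"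
      then have "link (A \<inter> W) (W - X - A \<inter> W) X q" using Q[OF I] by blast
      then show False
        by (rule link_crosses[where F = "F1 \<union> F2" and C = A]) (use q XA WV in auto)
    qed
    then show ?thesis using I by blast
  qed
  have finX: "finite {X. X \<subseteq> V \<and> card X \<le> L}" using finite_V by (auto intro: finite_subset[of _ "Pow V"])
  have finCL: "finite (CL X)" for X
    using finW by (auto simp: CL_def intro: finite_subset[of _ "Pow W"])
  have Isub: "I \<subseteq> (SIGMA X:{X. X \<subseteq> V \<and> card X \<le> L}. CL X)" by (auto simp: I_def)
  have finSig: "finite (SIGMA X:{X. X \<subseteq> V \<and> card X \<le> L}. CL X)" using finX finCL by auto
  then have finI: "finite I" using Isub finite_subset by blast
  have cardCL: "card (CL X) \<le> 2 ^ n" if X: "X \<subseteq> V" "card X \<le> L" for X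
  proof -
    have "card (CL X) \<le> 2 ^ card (cluster F1 (W - X) ` (W - X))"
      unfolding CL_def using finW by (intro card_closed_sets_le) auto
    also have "real (card (cluster F1 (W - X) ` (W - X))) \<le> card V / s + m * card X"
      unfolding W_def using assms(2,4) X(1) by (intro card_big_clusters_le)
    then have "real (card (cluster F1 (W - X) ` (W - X))) \<le> n"
      using n mult_left_mono[of "real (card X)" "real L" "real m"] X(2) by simp
    then have "(2::nat) ^ card (cluster F1 (W - X) ` (W - X)) \<le> 2 ^ n" by (intro power_increasing) auto
    finally show ?thesis .
  qed
  have "card I \<le> card (SIGMA X:{X. X \<subseteq> V \<and> card X \<le> L}. CL X)" using Isub finSig by (rule card_mono[rotated])
  also have "\<dots> = (\<Sum>X\<in>{X. X \<subseteq> V \<and> card X \<le> L}. card (CL X))" using finX finCL by (intro card_SigmaI) auto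
  also have "\<dots> \<le> (\<Sum>X\<in>{X. X \<subseteq> V \<and> card X \<le> L}. 2 ^ n)" using cardCL by (intro sum_mono) auto
  also have "\<dots> = card {X. X \<subseteq> V \<and> card X \<le> L} * 2 ^ n" by simp
  also have "\<dots> \<le> (card V + 1) ^ L * 2 ^ n" using card_small_subsets_le[OF finite_V] by (intro mult_right_mono) auto
  finally have cardI: "real (card I) \<le> (real (card V) + 1) ^ L * 2 ^ n"
    unfolding of_nat_le_iff[where 'a = real, symmetric] by (simp add: add.commute)
  have "measure_pmf.prob (percolate E p) {F2. \<forall>c. is_cycle (V, F1 \<union> F2) c \<longrightarrow> length c < L} \<le>
      measure_pmf.prob (percolate E p) (\<Union>i\<in>I. Bad i)"
    using cover by (intro measure_pmf.finite_measure_mono_AE AE_pmfI) auto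
  also have "\<dots> \<le> (\<Sum>i\<in>I. measure_pmf.prob (percolate E p) (Bad i))"
    using finI by (intro measure_pmf.finite_measure_subadditive_finite) auto
  also have "\<dots> \<le> (\<Sum>i\<in>I. (1 - p ^ 3) ^ t)"
  proof (intro sum_mono)
    fix i assume "i \<in> I"
    moreover obtain X A where i: "i = (X, A)" by (cases i)
    ultimately show "measure_pmf.prob (percolate E p) (Bad i) \<le> (1 - p ^ 3) ^ t"
      using Q[of X A] assms(5,6) unfolding i Bad_def prod.case
      by (intro prob_all_links_closed_le[of _ A "W - X - A" X]) auto
  qed
  also have "\<dots> = card I * (1 - p ^ 3) ^ t" by simp
  also have "\<dots> \<le> (real (card V) + 1) ^ L * 2 ^ n * (1 - p ^ 3) ^ t"
    using cardI assms(5,6) by (intro mult_right_mono) (auto simp: power_le_one)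
  finally show ?thesis .
qed

end

section \<open>Long cycles in the percolated hypercube\<close>

lemma expanding_graph_cube: "expanding_graph (cubeV m) (cubeE m) m"
proof
  show "\<exists>x y. e = {x, y}" if "e \<in> cubeE m" for e using that cubeE_iff by blast
  show "x \<in> cubeV m \<and> y \<in> cubeV m" if "{x, y} \<in> cubeE m" for x y using cube_edge[OF that] by blast
qed (simp_all add: card_cube_nbrs cube_half_isoperimetry)

text \<open>Integrate over the first round: \<open>B\<close> collects its bad outcomes, and outside
  \<open>B\<close> the bound \<open>b\<close> for the second round is uniform.\<close>

lemma prob_sprinkle_le:
  assumes "finite E" "0 \<le> p" "p \<le> 1" "0 \<le> q" "q \<le> 1" "0 \<le> b"
    and "\<And>F. F \<subseteq> E \<Longrightarrow> F \<notin> B \<Longrightarrow> measure_pmf.prob (percolate E q) {G. P (F \<union> G)} \<le> b"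
  shows "measure_pmf.prob (percolate E (1 - (1 - p) * (1 - q))) {F. P F} \<le>
    measure_pmf.prob (percolate E p) B + b"
proof -
  have "measure_pmf.prob (percolate E (1 - (1 - p) * (1 - q))) {F. P F} =
      measure_pmf.prob (pair_pmf (percolate E p) (percolate E q)) {(F, G). P (F \<union> G)}"
    unfolding percolate_sprinkle[OF assms(1-5)] by (simp add: vimage_def case_prod_beta')
  also have "\<dots> = (\<integral>F. measure_pmf.prob (percolate E q) {G. P (F \<union> G)} \<partial>measure_pmf (percolate E p))"
    by (rule prob_pair)
  also have "\<dots> \<le> (\<integral>F. indicator B F + b \<partial>measure_pmf (percolate E p))"
  proof (intro integral_mono_AE AE_pmfI)
    fix F assume "F \<in> set_pmf (percolate E p)"
    then have "F \<subseteq> E" by (rule percolate_subset)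
    show "measure_pmf.prob (percolate E q) {G. P (F \<union> G)} \<le> indicator B F + b"
    proof (cases "F \<in> B")
      case True
      then have "indicator B F = (1::real)" by simp
      then show ?thesis
        using measure_pmf.prob_le_1[of "percolate E q" "{G. P (F \<union> G)}"] assms(6) by linarith
    qed (use assms(7)[OF \<open>F \<subseteq> E\<close>] in simp)
  qed (auto intro!: measure_pmf.integrable_const_bound[where B = 1] simp: less_top[symmetric])
  also have "\<dots> = measure_pmf.prob (percolate E p) B + b"
    by (subst Bochner_Integration.integral_add) (auto simp: less_top[symmetric])
  finally show ?thesis .
qed

lemma prob_no_long_cycle_cube_le:
  fixes m s K L n t :: nat and p q \<eta> :: real
  assumes pq: "0 \<le> p" "p \<le> 1" "0 \<le> q" "q \<le> 1" and "0 < \<eta>" "0 < s" "K \<le> m" "3 \<le> L" "0 < m"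
    and growth: "p * (real m - K - log 2 s) \<ge> 1 + \<eta>"
    and n: "2 ^ m / s + m * L \<le> n"
    and t: "12 * real m ^ 2 * (real L + 4 * t) + 4 * L \<le> 2 ^ m / (4 * m)"
  shows "measure_pmf.prob (percolate (cubeE m) (1 - (1 - p) * (1 - q)))
      {F. \<forall>c. is_cycle (cubeV m, F) c \<longrightarrow> length c < L} \<le>
    32 * m ^ 2 * (1 / (1 + \<eta>)) ^ K + (2 ^ m + 1) ^ L * 2 ^ n * (1 - q ^ 3) ^ t"
proof -
  interpret expanding_graph "cubeV m" "cubeE m" m by (rule expanding_graph_cube)
  \<comment> \<open>With fewer than \<open>a\<close> isolated vertices, \<open>m\<close> times their
    number is at most 1/32 of \<open>2 ^ m / m\<close>, the guaranteed order of
    \<open>card W\<close>.\<close>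
  define a where "a = 2 ^ m / (32 * real m ^ 2)"
  have a: "0 < a" using assms(9) by (simp add: a_def)
  let ?I = "\<lambda>F. isolated (cubeV m) (cubeE m) (big (cubeV m) s F)"
  let ?B = "{F. a \<le> real (card (?I F))}"
  have q3: "0 \<le> 1 - q ^ 3" using pq by (simp add: power_le_one)
  have "measure_pmf.prob (percolate (cubeE m) p) ?B \<le> card (cubeV m) * (1 / (1 + \<eta>)) ^ K / a"
  proof (rule prob_card_ge_le[where B = ?I and V = "cubeV m", OF _ a])
    show "measure_pmf.prob (percolate (cubeE m) p) {F. v \<in> ?I F} \<le> (1 / (1 + \<eta>)) ^ K"
      if "v \<in> cubeV m" for v
      using that assms(7) pq(1,2) assms(5,6) growth by (rule prob_isolated_le)
  qed (auto simp: isolated_def)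
  also have "\<dots> = 32 * m ^ 2 * (1 / (1 + \<eta>)) ^ K"
    using assms(9) by (simp add: a_def field_simps)
  finally have 1: "measure_pmf.prob (percolate (cubeE m) p) ?B \<le> 32 * m ^ 2 * (1 / (1 + \<eta>)) ^ K" .
  have 2: "measure_pmf.prob (percolate (cubeE m) q)
      {G. \<forall>c. is_cycle (cubeV m, F \<union> G) c \<longrightarrow> length c < L} \<le>
      (2 ^ m + 1) ^ L * 2 ^ n * (1 - q ^ 3) ^ t"
    if F: "F \<subseteq> cubeE m" "F \<notin> ?B" for F
  proof -
    define W where "W = big (cubeV m) s F"
    define i where "i = card (isolated (cubeV m) (cubeE m) W)"
    have WV: "W \<subseteq> cubeV m" by (auto simp: W_def big_def)
    then have finW: "finite W" by (rule finite_subset) simp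
    have i: "real i < a" using F(2) by (simp add: i_def W_def)
    \<comment> \<open>A vertex that is not isolated is a neighbour of \<open>W\<close>, so
      \<open>W\<close> cannot be much smaller than \<open>2 ^ m / m\<close>.\<close>
    have "cubeV m \<subseteq> isolated (cubeV m) (cubeE m) W \<union> (\<Union>x\<in>W. {y. {x, y} \<in> cubeE m})"
      by (auto simp: isolated_def insert_commute)
    then have "card (cubeV m) \<le> card (isolated (cubeV m) (cubeE m) W \<union> (\<Union>x\<in>W. {y. {x, y} \<in> cubeE m}))"
      using finW finite_nbrs by (intro card_mono) (auto simp: isolated_def)
    also have "\<dots> \<le> i + card (\<Union>x\<in>W. {y. {x, y} \<in> cubeE m})" unfolding i_def by (rule card_Un_le)
    also have "card (\<Union>x\<in>W. {y. {x, y} \<in> cubeE m}) \<le> m * card W" using finW by (rule card_UN_nbrs_le)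
    finally have "2 ^ m \<le> i + m * card W" by simp
    then have "real (2 ^ m) \<le> real (i + m * card W)" by (simp only: of_nat_le_iff)
    then have N: "2 ^ m \<le> real i + m * card W" by simp
    define x where "x = (2 ^ m :: real) / m"
    have m1: "1 \<le> real m" using assms(9) by simp
    have x: "2 ^ m = x * m" "0 < x" using assms(9) by (auto simp: x_def)
    have am: "a * m = x / 32" using assms(9) by (simp add: a_def x_def power2_eq_square)
    have "a \<le> x / 32" using am a m1 mult_left_mono[of 1 "real m" a] by linarith
    then have "a \<le> x / 32 * m" using x(2) m1 mult_left_mono[of 1 "real m" "x / 32"] by linarith
    then have "x * m \<le> (x / 32 + card W) * m" using N i x(1) by (simp add: algebra_simps)
    then have W1: "x \<le> x / 32 + card W" using m1 by (subst (asm) mult_le_cancel_right_pos) auto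
    have "real (4 * ((m * m + m + 1) * (L + 4 * t) + m * i) + 4 * L) =
        4 * (real m ^ 2 + m + 1) * (real L + 4 * t) + 4 * (m * real i) + 4 * L"
      by (simp add: power2_eq_square algebra_simps)
    \<comment> \<open>This is the origin of the factor 12 in hypothesis \<open>t\<close>. In total
      \<open>3 / 8\<close> of \<open>x\<close> is needed, while \<open>W\<close> has at least
      \<open>31 / 32\<close> of it.\<close>
    also have "\<dots> \<le> 4 * (3 * real m ^ 2) * (real L + 4 * t) + 4 * (a * m) + 4 * L"
    proof -
      have "1 \<le> real m ^ 2" "real m \<le> real m ^ 2"
        using m1 by (simp_all add: power2_eq_square mult_left_mono[of 1 "real m" "real m", simplified] mult_ge1_I)
      then have "real m ^ 2 + m + 1 \<le> 3 * real m ^ 2" by linarith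
      then have "4 * (real m ^ 2 + m + 1) * (real L + 4 * t) \<le> 4 * (3 * real m ^ 2) * (real L + 4 * t)"
        by (rule mult_right_mono[OF mult_left_mono]) auto
      moreover have "m * real i \<le> a * m" using i m1 by (simp add: mult.commute)
      ultimately show ?thesis by linarith
    qed
    also have "\<dots> \<le> x / 4 + x / 8"
      using t am assms(9) by (simp add: x_def)
    also have "\<dots> < card W" using W1 x(2) by linarith
    finally have "4 * ((m * m + m + 1) * (L + 4 * t) + m * i) + 4 * L < card W"
      by (simp only: of_nat_less_iff)
    then have "measure_pmf.prob (percolate (cubeE m) q)
        {G. \<forall>c. is_cycle (cubeV m, F \<union> G) c \<longrightarrow> length c < L} \<le>
        (real (card (cubeV m)) + 1) ^ L * 2 ^ n * (1 - q ^ 3) ^ t"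
      using F(1) assms(6,8) pq n unfolding i_def W_def by (intro prob_no_long_cycle_le) auto
    then show ?thesis by simp
  qed
  have "measure_pmf.prob (percolate (cubeE m) (1 - (1 - p) * (1 - q)))
      {F. \<forall>c. is_cycle (cubeV m, F) c \<longrightarrow> length c < L} \<le>
      measure_pmf.prob (percolate (cubeE m) p) ?B + (2 ^ m + 1) ^ L * 2 ^ n * (1 - q ^ 3) ^ t"
    using pq q3 2 by (intro prob_sprinkle_le) auto
  then show ?thesis using 1 by linarith
qed

text \<open>The first term is the Markov bound for isolated vertices, the second the union bound in
  exponential form. The summands \<open>+ 1\<close> and \<open>- 1\<close> absorb the rounding of
  the parameters. The negative part of the exponent has order \<open>2 ^ m / m ^ 6\<close>, the
  positive one order \<open>2 ^ m / m ^ 8\<close>.\<close>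

definition failure_bound :: "real \<Rightarrow> nat \<Rightarrow> real" where
  "failure_bound \<epsilon> m = 32 * real m ^ 2 * (1 / (1 + \<epsilon> / 4)) powr (sqrt m - 1) +
    exp ((2 * real m + 1) * (2 ^ m / (4 * real m ^ 32) + 1) + 2 ^ m / real m ^ 8 + 1
      - (\<epsilon> / (2 * real m)) ^ 3 * (2 ^ m / (400 * real m ^ 3) - 1))"

lemma failure_bound_tendsto_0:
  assumes "0 < \<epsilon>"
  shows "failure_bound \<epsilon> \<longlonglongrightarrow> 0"
proof -
  have c: "0 < 1 / (1 + \<epsilon> / 4)" "1 / (1 + \<epsilon> / 4) < 1" using assms by auto
  have "(\<lambda>m::nat. 32 * real m ^ 2 * c powr (sqrt m - 1)) \<longlonglongrightarrow> 0" if "0 < c" "c < 1" for c :: real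
    using that by real_asymp
  note 1 = this[OF c]
  have 2: "(\<lambda>m::nat. exp ((2 * real m + 1) * (2 ^ m / (4 * real m ^ 32) + 1) + 2 ^ m / real m ^ 8 + 1
      - (\<epsilon> / (2 * real m)) ^ 3 * (2 ^ m / (400 * real m ^ 3) - 1))) \<longlonglongrightarrow> 0"
    using assms by real_asymp
  show ?thesis unfolding failure_bound_def using tendsto_add[OF 1 2] by simp
qed

lemma eventually_prob_no_long_cycle_le:
  assumes "0 < \<epsilon>"
  shows "\<forall>\<^sub>F m in sequentially. measure_pmf.prob (percolate (cubeE m) ((1 + \<epsilon>) / m))
      {F. \<forall>c. is_cycle (cubeV m, F) c \<longrightarrow> length c < nat \<lceil>2 ^ m / (4 * real m ^ 32)\<rceil>} \<le>
    failure_bound \<epsilon> m"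
proof -
  have "\<forall>\<^sub>F m::nat in sequentially. 1 + \<epsilon> < m" using assms by real_asymp
  \<comment> \<open>\<open>sqrt m\<close> and \<open>8 * log 2 m\<close> are of lower order than
    \<open>m\<close>, so the larger side tends to \<open>1 + \<epsilon> / 2\<close>.\<close>
  moreover have "\<forall>\<^sub>F m::nat in sequentially.
      (1 + \<epsilon> / 2) / m * (real m - sqrt m - log 2 (real m ^ 8)) \<ge> 1 + \<epsilon> / 4"
    using assms by real_asymp
  moreover have "\<forall>\<^sub>F m::nat in sequentially. 3 \<le> 2 ^ m / (4 * real m ^ 32)" by real_asymp
  \<comment> \<open>The links contribute \<open>48 / 400\<close> of \<open>2 ^ m / m\<close>, below
    the allowed quarter; the other terms are of lower order. This is the reason for the constant
    400.\<close>
  moreover have "\<forall>\<^sub>F m::nat in sequentially.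
      12 * real m ^ 2 * ((2 ^ m / (4 * real m ^ 32) + 1) + 4 * (2 ^ m / (400 * real m ^ 3))) +
        4 * (2 ^ m / (4 * real m ^ 32) + 1) \<le> 2 ^ m / (4 * m)" by real_asymp
  moreover have "\<forall>\<^sub>F m::nat in sequentially. 1 \<le> m" by (rule eventually_ge_at_top)
  ultimately show ?thesis
  proof eventually_elim
    case (elim m)
    define x where "x = 2 ^ m / (4 * real m ^ 32)"
    define L where "L = nat \<lceil>x\<rceil>"
    \<comment> \<open>\<open>K\<close> has to grow faster than \<open>log m\<close> for the Markov
      bound and slower than \<open>m\<close> for the growth condition.\<close>
    define K where "K = nat \<lfloor>sqrt m\<rfloor>"
    define t where "t = nat \<lfloor>2 ^ m / (400 * real m ^ 3)\<rfloor>"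
    define n where "n = nat \<lceil>2 ^ m / real m ^ 8 + m * L\<rceil>"
    define p where "p = (1 + \<epsilon> / 2) / m"
    \<comment> \<open>\<open>q\<close> solves
      \<open>1 - (1 - p) * (1 - q) = (1 + \<epsilon>) / m\<close>, so the two rounds combine exactly
      to the given probability.\<close>
    define q where "q = ((1 + \<epsilon>) / m - p) / (1 - p)"
    have m: "0 < m" "1 \<le> real m" using elim by auto
    have p: "0 \<le> p" "p < 1" "p \<le> (1 + \<epsilon>) / m" using elim(1) assms m by (auto simp: p_def field_simps)
    have pm: "(1 + \<epsilon>) / m \<le> 1" using elim(1) m by simp
    have diff: "(1 + \<epsilon>) / m - p = \<epsilon> / (2 * m)" using m by (simp add: p_def field_simps)
    have q: "0 \<le> q" "q \<le> 1" "\<epsilon> / (2 * m) \<le> q"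
    proof -
      show "0 \<le> q" using p by (simp add: q_def)
      show "q \<le> 1" using p pm by (simp add: q_def)
      have "((1 + \<epsilon>) / m - p) / 1 \<le> q" unfolding q_def using p by (intro divide_left_mono) auto
      then show "\<epsilon> / (2 * m) \<le> q" using diff by simp
    qed
    have comb: "1 - (1 - p) * (1 - q) = (1 + \<epsilon>) / m"
    proof -
      have "(1 - p) * q = (1 + \<epsilon>) / m - p" using p(2) by (simp add: q_def)
      then show ?thesis by (simp add: right_diff_distrib)
    qed
    have L: "x \<le> L" "L \<le> x + 1" "3 \<le> L"
    proof -
      have x3: "3 \<le> x" using elim(3) by (simp add: x_def)
      then have "real L = of_int \<lceil>x\<rceil>" by (simp add: L_def)
      then show "x \<le> L" "L \<le> x + 1" by linarith+
      then show "3 \<le> L" using x3 by linarith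
    qed
    have K: "real K \<le> sqrt m" "sqrt m - 1 \<le> K"
      unfolding K_def using real_sqrt_ge_zero[of "real m"] by linarith+
    have "sqrt m \<le> sqrt (real m ^ 2)" using m by (intro real_sqrt_le_mono) (simp add: power2_eq_square)
    then have Km: "K \<le> m" using K by simp
    have t: "real t \<le> 2 ^ m / (400 * real m ^ 3)" "2 ^ m / (400 * real m ^ 3) - 1 \<le> t"
    proof -
      have "0 \<le> 2 ^ m / (400 * real m ^ 3)" by simp
      then show "real t \<le> 2 ^ m / (400 * real m ^ 3)" "2 ^ m / (400 * real m ^ 3) - 1 \<le> t"
        unfolding t_def by linarith+
    qed
    have n: "2 ^ m / real m ^ 8 + m * L \<le> n" "n \<le> 2 ^ m / real m ^ 8 + m * L + 1"
    proof -
      have "0 \<le> 2 ^ m / real m ^ 8 + m * L" by simp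
      then show "2 ^ m / real m ^ 8 + m * L \<le> n" "n \<le> 2 ^ m / real m ^ 8 + m * L + 1"
        unfolding n_def by linarith+
    qed
    have "measure_pmf.prob (percolate (cubeE m) (1 - (1 - p) * (1 - q)))
        {F. \<forall>c. is_cycle (cubeV m, F) c \<longrightarrow> length c < L} \<le>
        32 * m ^ 2 * (1 / (1 + \<epsilon> / 4)) ^ K + (2 ^ m + 1) ^ L * 2 ^ n * (1 - q ^ 3) ^ t"
    proof (rule prob_no_long_cycle_cube_le[where s = "m ^ 8"])
      have "1 + \<epsilon> / 4 \<le> p * (real m - sqrt m - log 2 (real m ^ 8))" using elim(2) by (simp add: p_def)
      also have "\<dots> \<le> p * (real m - K - log 2 (real m ^ 8))" using K p by (intro mult_left_mono) auto
      finally show "1 + \<epsilon> / 4 \<le> p * (real m - K - log 2 (real (m ^ 8)))" by simp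
      show "2 ^ m / real (m ^ 8) + m * L \<le> n" using n by simp
      have "12 * real m ^ 2 * (real L + 4 * t) + 4 * L \<le>
          12 * real m ^ 2 * ((x + 1) + 4 * (2 ^ m / (400 * real m ^ 3))) + 4 * (x + 1)"
        using L t by (intro add_mono mult_left_mono) auto
      also have "\<dots> \<le> 2 ^ m / (4 * m)" using elim(4) by (simp add: x_def)
      finally show "12 * real m ^ 2 * (real L + 4 * t) + 4 * L \<le> 2 ^ m / (4 * m)" .
    qed (use p q assms m Km L(3) in auto)
    also have "(1 / (1 + \<epsilon> / 4)) ^ K \<le> (1 / (1 + \<epsilon> / 4)) powr (sqrt m - 1)"
    proof -
      have "(1 / (1 + \<epsilon> / 4)) ^ K = (1 / (1 + \<epsilon> / 4)) powr K" using assms by (simp add: powr_realpow)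
      also have "\<dots> \<le> (1 / (1 + \<epsilon> / 4)) powr (sqrt m - 1)"
        using K assms by (intro powr_mono') auto
      finally show ?thesis .
    qed
    also have "(2 ^ m + 1) ^ L * 2 ^ n * (1 - q ^ 3) ^ t \<le>
        exp ((2 * real m + 1) * (x + 1) + 2 ^ m / real m ^ 8 + 1
          - (\<epsilon> / (2 * real m)) ^ 3 * (2 ^ m / (400 * real m ^ 3) - 1))"
    proof -
      \<comment> \<open>All factors become exponentials. The \<open>(m + 1) * L\<close> from the
        separators and the \<open>m * L\<close> inside \<open>n\<close> add up to the coefficient
        \<open>2 * m + 1\<close>.\<close>
      have e2: "(2::real) \<le> exp 1" using exp_ge_add_one_self[of 1] by simp
      have "(2 ^ m + 1 :: real) \<le> 2 ^ (m + 1)" by simp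
      also have "\<dots> \<le> exp 1 ^ (m + 1)" using e2 by (intro power_mono) auto
      also have "\<dots> = exp (real (m + 1))" unfolding exp_of_nat_mult[symmetric] by simp
      finally have "(2 ^ m + 1 :: real) ^ L \<le> exp (real (m + 1)) ^ L" by (intro power_mono) auto
      also have "\<dots> = exp (real (m + 1) * L)" by (rule exp_of_nat2_mult[symmetric])
      finally have b1: "(2 ^ m + 1 :: real) ^ L \<le> exp (real (m + 1) * L)" .
      have "(2::real) ^ n \<le> exp 1 ^ n" using e2 by (intro power_mono) auto
      then have b2: "(2::real) ^ n \<le> exp n" unfolding exp_of_nat_mult[symmetric] by simp
      have "(1 - q ^ 3) ^ t \<le> exp (- (q ^ 3)) ^ t"
        using exp_ge_add_one_self[of "- (q ^ 3)"] q by (intro power_mono) (auto simp: power_le_one)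
      then have b3: "(1 - q ^ 3) ^ t \<le> exp (- (q ^ 3) * t)" by (simp only: exp_of_nat2_mult)
      have "(2 ^ m + 1) ^ L * 2 ^ n * (1 - q ^ 3) ^ t \<le> exp (real (m + 1) * L) * exp n * exp (- (q ^ 3) * t)"
        using b1 b2 b3 q by (intro mult_mono) (auto simp: power_le_one)
      also have "\<dots> = exp (real (m + 1) * L + n - q ^ 3 * t)"
        by (simp add: exp_add[symmetric] exp_diff[symmetric])
      also have "\<dots> \<le> exp ((2 * real m + 1) * (x + 1) + 2 ^ m / real m ^ 8 + 1
          - (\<epsilon> / (2 * real m)) ^ 3 * (2 ^ m / (400 * real m ^ 3) - 1))"
      proof -
        have "(\<epsilon> / (2 * real m)) ^ 3 * (2 ^ m / (400 * real m ^ 3) - 1) \<le> (\<epsilon> / (2 * real m)) ^ 3 * t"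
          using t assms m by (intro mult_left_mono) auto
        also have "\<dots> \<le> q ^ 3 * t" using q assms m by (intro mult_right_mono power_mono) auto
        finally have c1: "(\<epsilon> / (2 * real m)) ^ 3 * (2 ^ m / (400 * real m ^ 3) - 1) \<le> q ^ 3 * t" .
        have "real (m + 1) * L + n \<le> (2 * real m + 1) * L + 2 ^ m / real m ^ 8 + 1"
          using n(2) by (simp add: algebra_simps)
        also have "\<dots> \<le> (2 * real m + 1) * (x + 1) + 2 ^ m / real m ^ 8 + 1"
          using L(2) m by (intro add_mono mult_left_mono) auto
        finally show ?thesis using c1 by simp
      qed
      finally show ?thesis .
    qed
    finally show ?case
      using m unfolding comb failure_bound_def L_def x_def by (simp add: mult_left_mono)
  qed
qed

theorem theorem1p9:
  fixes \<epsilon> :: real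
  assumes "\<epsilon> > 0"
  shows "((\<lambda>m::nat. measure_pmf.prob (random_subgraph (hypercube m) ((1 + \<epsilon>) / real m))
            {H. \<exists>c. is_cycle H c \<and> real (length c) \<ge> 2 ^ m / (4 * real m ^ 32)})
          \<longlonglongrightarrow> 1) \<and>
         (\<exists>\<delta> :: nat \<Rightarrow> real. \<delta> \<in> o(\<lambda>_. 1) \<and>
            (\<forall>m\<ge>1. 2 ^ m / (4 * real m ^ 32) = 2 powr ((1 - \<delta> m) * real m)))"
proof (intro conjI exI allI impI)
  have lower: "\<forall>\<^sub>F m in sequentially. 1 - failure_bound \<epsilon> m \<le>
      measure_pmf.prob (random_subgraph (hypercube m) ((1 + \<epsilon>) / real m))
        {H. \<exists>c. is_cycle H c \<and> real (length c) \<ge> 2 ^ m / (4 * real m ^ 32)}"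
    using eventually_prob_no_long_cycle_le[OF assms]
  proof eventually_elim
    case (elim m)
    let ?M = "percolate (cubeE m) ((1 + \<epsilon>) / m)"
    let ?S = "{F. \<forall>c. is_cycle (cubeV m, F) c \<longrightarrow> length c < nat \<lceil>2 ^ m / (4 * real m ^ 32)\<rceil>}"
    \<comment> \<open>Lengths are integers, so rounding the bound up loses nothing.\<close>
    have "(length c < nat \<lceil>2 ^ m / (4 * real m ^ 32)\<rceil>) = (\<not> real (length c) \<ge> 2 ^ m / (4 * real m ^ 32))"
      for c :: "(nat \<Rightarrow> nat) list"
      by linarith
    then have "{F. \<exists>c. is_cycle (cubeV m, F) c \<and> real (length c) \<ge> 2 ^ m / (4 * real m ^ 32)} = UNIV - ?S"
      by auto
    then have "measure_pmf.prob (random_subgraph (hypercube m) ((1 + \<epsilon>) / real m))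
        {H. \<exists>c. is_cycle H c \<and> real (length c) \<ge> 2 ^ m / (4 * real m ^ 32)} = measure_pmf.prob ?M (UNIV - ?S)"
      by (simp add: random_subgraph_percolate vimage_def)
    also have "\<dots> = 1 - measure_pmf.prob ?M ?S" using measure_pmf.prob_compl[of ?S ?M] by simp
    finally show ?case using elim by simp
  qed
  have lim: "(\<lambda>m. 1 - failure_bound \<epsilon> m) \<longlonglongrightarrow> 1"
    using tendsto_diff[OF tendsto_const failure_bound_tendsto_0[OF assms], of 1] by simp
  have upper: "\<forall>\<^sub>F m in sequentially. measure_pmf.prob (random_subgraph (hypercube m) ((1 + \<epsilon>) / real m))
      {H. \<exists>c. is_cycle H c \<and> real (length c) \<ge> 2 ^ m / (4 * real m ^ 32)} \<le> 1" by simp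
  show "(\<lambda>m::nat. measure_pmf.prob (random_subgraph (hypercube m) ((1 + \<epsilon>) / real m))
      {H. \<exists>c. is_cycle H c \<and> real (length c) \<ge> 2 ^ m / (4 * real m ^ 32)}) \<longlonglongrightarrow> 1"
    by (rule tendsto_sandwich[OF lower upper lim tendsto_const])
next
  \<comment> \<open>The witness for \<open>\<delta>\<close> comes from solving the claimed identity:
    the denominator costs \<open>log 2 (4 * m ^ 32)\<close> in the exponent, divided here by
    \<open>m\<close>.\<close>
  show "(\<lambda>m. log 2 (4 * real m ^ 32) / real m) \<in> o(\<lambda>_. 1)" by real_asymp
next
  fix m :: nat assume "1 \<le> m"
  then have "(1 - log 2 (4 * real m ^ 32) / m) * m = real m - log 2 (4 * real m ^ 32)"
    by (simp add: field_simps)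
  then show "2 ^ m / (4 * real m ^ 32) = 2 powr ((1 - log 2 (4 * real m ^ 32) / m) * m)"
    using \<open>1 \<le> m\<close> by (simp add: powr_diff powr_realpow)
qed

end
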